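(* Let $S=\{1,\ldots,n\}$ with $n\geq 2$ be the state space of a Markov decision process (MDP) with a safety objective, where the state to be avoided is $s^*=n$ and the action sets $A(s)$, $s\in S$, are finite and nonempty. Suppose that for each state $s\in S\setminus\{n\}$ and each action $a\in A(s)$ the transition distribution $(p(z\mid s,a))_{z\in S}$ is drawn at random, independently over all such pairs $(s,a)$, from some continuous distribution (i.e. one having a density with respect to $(n-1)$-dimensional Lebesgue measure, possibly depending on $(s,a)$) on $\{(q_1,\ldots,q_n)\in(0,1)^n : q_1+\cdots+q_n=1\}$. Then, with probability 1 over this draw, there is a pure stationary strategy that overtakes (in the sense of the safety objective) each other stationary strategy at each initial state $s\in S\setminus\{n\}$ (where stationary strategies that differ only at the state $n$ are identified).
   Context: An MDP with a safety objective is given by a finite set $S$ of states with a distinguished state $s^*\in S$ that the decision maker wants to avoid, for each $s\in S$ a nonempty finite set $A(s)$ of actions, and for each $s\in S$, $a\in A(s)$ a probability distribution $p(\cdot\mid s,a)$ on $S$. Play runs over periods $1,2,3,\ldots$: it starts at period 1 in an initial state $s_1\in S\setminus\{s^*\}$; at each period $t$ the decision maker chooses an action $a_t\in A(s_t)$ and $s_{t+1}$ is drawn from $p(\cdot\mid s_t,a_t)$. A stationary strategy $\sigma$ assigns to each state $s$ a probability distribution $\sigma(s)$ on $A(s)$, which is used to choose the action whenever the current state is $s$; it is pure if each $\sigma(s)$ puts probability 1 on one action. $\mathbb{P}_{s\sigma}$ denotes the probability measure on infinite histories $(s_1,a_1,s_2,a_2,\ldots)$ induced by initial state $s$ and strategy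 $\sigma$. Let $t^*$ be the first period at which the state is $s^*$ ($t^*=\infty$ if $s^*$ is never reached). For the safety objective, a strategy $\sigma$ overtakes a strategy $\sigma'$ at the initial state $s$ if there is $T\in\mathbb{N}$ such that $\mathbb{P}_{s\sigma}(t^*\leq t)<\mathbb{P}_{s\sigma'}(t^*\leq t)$ for all $t\geq T$. *)

theory Defs
  imports "HOL-Probability.Probability"
begin

text \<open>Actions of all states share one type; only those in \<open>A s\<close> are available at \<open>s\<close>.\<close>

locale safety_mdp =
  fixes S :: "'s set" and avoid :: 's and A :: "'s \<Rightarrow> 'a set"
    and p :: "'s \<Rightarrow> 'a \<Rightarrow> 's pmf"
  assumes finite_S: "finite S"
    and avoid_in_S: "avoid \<in> S"
    and finite_A: "\<And>s. s \<in> S \<Longrightarrow> finite (A s)"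
    and nonempty_A: "\<And>s. s \<in> S \<Longrightarrow> A s \<noteq> {}"
    and p_in_S: "\<And>s a. s \<in> S \<Longrightarrow> a \<in> A s \<Longrightarrow> set_pmf (p s a) \<subseteq> S"

definition stationary_strategy :: "'s set \<Rightarrow> ('s \<Rightarrow> 'a set) \<Rightarrow> ('s \<Rightarrow> 'a pmf) \<Rightarrow> bool" where
  "stationary_strategy S A \<sigma> \<longleftrightarrow> (\<forall>s\<in>S. set_pmf (\<sigma> s) \<subseteq> A s)"

definition pure_stationary_strategy :: "'s set \<Rightarrow> ('s \<Rightarrow> 'a set) \<Rightarrow> ('s \<Rightarrow> 'a pmf) \<Rightarrow> bool" where
  "pure_stationary_strategy S A \<sigma> \<longleftrightarrow>
     stationary_strategy S A \<sigma> \<and> (\<forall>s\<in>S. \<exists>a. \<sigma> s = return_pmf a)"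

text \<open>
  Infinite histories \<open>(s\<^sub>1, a\<^sub>1, s\<^sub>2, a\<^sub>2, \<dots>)\<close> are functions \<open>h :: nat \<Rightarrow> 's \<times> 'a\<close>, where
  \<open>h i\<close> is the state-action pair at period \<open>Suc i\<close>. Their law is the Ionescu-Tulcea measure of
  the kernels below, for the discrete sigma-algebra on each coordinate.
\<close>

definition play_kernel ::
  "('s \<Rightarrow> 'a \<Rightarrow> 's pmf) \<Rightarrow> 's \<Rightarrow> ('s \<Rightarrow> 'a pmf) \<Rightarrow> nat \<Rightarrow> (nat \<Rightarrow> 's \<times> 'a) \<Rightarrow> ('s \<times> 'a) measure" where
  "play_kernel p s \<sigma> i h = measure_pmf
     (bind_pmf (case i of 0 \<Rightarrow> return_pmf s | Suc j \<Rightarrow> p (fst (h j)) (snd (h j)))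
       (\<lambda>z. map_pmf (Pair z) (\<sigma> z)))"

definition play_measure ::
  "('s \<Rightarrow> 'a \<Rightarrow> 's pmf) \<Rightarrow> 's \<Rightarrow> ('s \<Rightarrow> 'a pmf) \<Rightarrow> (nat \<Rightarrow> 's \<times> 'a) measure" where
  "play_measure p s \<sigma> =
     projective_family.lim UNIV
       (Ionescu_Tulcea.CI (play_kernel p s \<sigma>) (\<lambda>_. count_space UNIV)) (\<lambda>_. count_space UNIV)"

lemma Ionescu_Tulcea_play_kernel:
  "Ionescu_Tulcea (play_kernel p s \<sigma>) (\<lambda>_. count_space UNIV)"
proof (rule Ionescu_Tulcea.intro)
  fix i :: nat
  show "play_kernel p s \<sigma> i \<in>
    PiM {0..<i} (\<lambda>_. count_space UNIV) \<rightarrow>\<^sub>M subprob_algebra (count_space UNIV)"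
  proof (cases i)
    case 0
    then show ?thesis
      unfolding play_kernel_def
      by (auto intro!: measurable_const simp: space_subprob_algebra measure_pmf.subprob_space_axioms)
  next
    case (Suc j)
    have "(\<lambda>h. h j) \<in> PiM {0..<i} (\<lambda>_. count_space UNIV) \<rightarrow>\<^sub>M count_space UNIV"
      by (rule measurable_component_singleton) (simp add: Suc)
    moreover have "(\<lambda>x. measure_pmf (bind_pmf (p (fst x) (snd x)) (\<lambda>z. map_pmf (Pair z) (\<sigma> z))))
        \<in> count_space UNIV \<rightarrow>\<^sub>M subprob_algebra (count_space UNIV)"
      by (auto simp: space_subprob_algebra measure_pmf.subprob_space_axioms)
    ultimately show ?thesis
      unfolding play_kernel_def Suc by (simp add: measurable_compose)
  qed
qed (simp add: play_kernel_def measure_pmf.prob_space_axioms)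

lemma prob_space_play_measure: "prob_space (play_measure p s \<sigma>)"
proof -
  interpret Ionescu_Tulcea "play_kernel p s \<sigma>" "\<lambda>_. count_space UNIV"
    by (rule Ionescu_Tulcea_play_kernel)
  have "emeasure PF.lim (PF.emb UNIV {} {\<lambda>_. undefined}) = emeasure (CI {}) {\<lambda>_. undefined}"
    by (rule lim) (simp_all add: PiM_empty)
  moreover have "space (CI {}) = {\<lambda>_. undefined}"
    by (simp add: CI_def space_PiM)
  moreover have "prob_space (CI {})"
    by (rule PF.prob_space_P) simp_all
  moreover have "PF.emb UNIV {} {\<lambda>_. undefined} = space PF.lim"
    by (auto simp: prod_emb_def space_PiM restrict_def)
  ultimately show ?thesis
    unfolding play_measure_def
    by (intro prob_spaceI) (metis prob_space.emeasure_space_1)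
qed

definition first_period :: "'s \<Rightarrow> (nat \<Rightarrow> 's \<times> 'a) \<Rightarrow> enat" where
  "first_period z h = (INF i \<in> {i. fst (h i) = z}. enat (Suc i))"

definition overtakes ::
  "'s \<Rightarrow> ('s \<Rightarrow> 'a \<Rightarrow> 's pmf) \<Rightarrow> 's \<Rightarrow> ('s \<Rightarrow> 'a pmf) \<Rightarrow> ('s \<Rightarrow> 'a pmf) \<Rightarrow> bool" where
  "overtakes avoid p s \<sigma> \<sigma>' \<longleftrightarrow> (\<exists>T. \<forall>t\<ge>T.
     \<P>(h in play_measure p s \<sigma>. first_period avoid h \<le> enat t)
       < \<P>(h in play_measure p s \<sigma>'. first_period avoid h \<le> enat t))"

definition open_simplex :: "nat \<Rightarrow> (nat \<Rightarrow> real) set" where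
  "open_simplex n = {q \<in> {1..n} \<rightarrow>\<^sub>E {0<..<1}. (\<Sum>i=1..n. q i) = 1}"

text \<open>
  The \<open>(n - 1)\<close>-dimensional Lebesgue measure on the simplex, carried over from the first \<open>n - 1\<close>
  coordinates. It differs from the surface measure induced by the Euclidean metric by the constant
  factor \<open>sqrt n\<close>, which does not affect which distributions have a density.
\<close>

definition simplex_lebesgue :: "nat \<Rightarrow> (nat \<Rightarrow> real) measure" where
  "simplex_lebesgue n = restrict_space
     (distr (PiM {1..<n} (\<lambda>_. lborel)) (PiM {1..n} (\<lambda>_. borel))
       (\<lambda>q. q(n := 1 - (\<Sum>i=1..<n. q i))))
     (open_simplex n)"

definition transition_vector :: "nat \<Rightarrow> (nat \<Rightarrow> 'a \<Rightarrow> nat pmf) \<Rightarrow> nat \<Rightarrow> 'a \<Rightarrow> nat \<Rightarrow> real" where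
  "transition_vector n p s a = (\<lambda>z\<in>{1..n}. pmf (p s a) z)"

end

theory Submission
  imports Defs
begin

text \<open>
  Write \<open>J = {1..<n}\<close>. Under a stationary strategy \<open>\<sigma>\<close>, the probability of surviving \<open>k\<close> steps from \<open>s\<close>
  is \<open>(P\<^sub>\<sigma>\<^sup>k 1)(s)\<close>, where \<open>P\<^sub>\<sigma>\<close> is the transition matrix restricted to \<open>J\<close>, whose entries are
  positive. Choose a pure \<open>\<sigma>\<close> with maximal Perron root \<open>\<rho>\<close> and let \<open>v > 0\<close> be its Perron vector.
  Maximality gives \<open>(\<Sum>z\<in>J. p(z | s,a) v(z)) \<le> \<rho> v(s)\<close> for all \<open>s\<close> and \<open>a\<close>: otherwise switching to
  \<open>a\<close> at \<open>s\<close> would increase the Perron root. For \<open>a \<noteq> \<sigma>(s)\<close>, equality confines \<open>p(\<cdot> | s,a)\<close> to a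
  hyperplane that is a function of the other, independent, transition vectors, so almost surely
  the inequality is strict. Then \<open>P\<^sub>\<tau> v \<le> \<rho> v\<close> with \<open>P\<^sub>\<tau> v \<noteq> \<rho> v\<close> for each other stationary \<open>\<tau>\<close>, so
  its survival probabilities decay at an exponential rate smaller than \<open>\<rho>\<close>. The Perron data are
  limits of the power iteration, hence measurable functions of the matrix.
\<close>

section \<open>Positive matrices\<close>

definition mat_app :: "'i set \<Rightarrow> ('i \<Rightarrow> 'i \<Rightarrow> real) \<Rightarrow> ('i \<Rightarrow> real) \<Rightarrow> 'i \<Rightarrow> real" where
  "mat_app J P x i = (\<Sum>j\<in>J. P i j * x j)"

definition mat_iter :: "'i set \<Rightarrow> ('i \<Rightarrow> 'i \<Rightarrow> real) \<Rightarrow> nat \<Rightarrow> 'i \<Rightarrow> real" where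
  "mat_iter J P k = (mat_app J P ^^ k) (\<lambda>_. 1)"

text \<open>Normalised to be 1 at the reference index \<open>i0\<close>. Taking the limit of the
  power iteration, instead of choosing an eigenvector, gives a measurable function of
  \<open>P\<close>; for positive \<open>P\<close> it is the Perron vector.\<close>

definition perron_vec :: "'i set \<Rightarrow> 'i \<Rightarrow> ('i \<Rightarrow> 'i \<Rightarrow> real) \<Rightarrow> 'i \<Rightarrow> real" where
  "perron_vec J i0 P i = lim (\<lambda>k. mat_iter J P k i / mat_iter J P k i0)"

text \<open>As the Perron vector is 1 at \<open>i0\<close>, coordinate \<open>i0\<close> of the
  eigenvalue equation reads off the eigenvalue.\<close>

definition perron_root :: "'i set \<Rightarrow> 'i \<Rightarrow> ('i \<Rightarrow> 'i \<Rightarrow> real) \<Rightarrow> real" where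
  "perron_root J i0 P = mat_app J P (perron_vec J i0 P) i0"

lemma mat_iter_0 [simp]: "mat_iter J P 0 i = 1"
  by (simp add: mat_iter_def)

lemma mat_iter_Suc: "mat_iter J P (Suc k) = mat_app J P (mat_iter J P k)"
  by (simp add: mat_iter_def)

lemma mat_app_cong:
  assumes "\<And>j. j \<in> J \<Longrightarrow> P i j = Q i j" "\<And>j. j \<in> J \<Longrightarrow> x j = y j"
  shows "mat_app J P x i = mat_app J Q y i"
  using assms by (simp add: mat_app_def)

lemma mat_app_scale: "mat_app J P (\<lambda>j. c * x j) i = c * mat_app J P x i"
  by (simp add: mat_app_def sum_distrib_left mult_ac)

lemma finite_positive_lower_bound:
  fixes f :: "'a \<Rightarrow> real"
  assumes "finite K" "\<And>x. x \<in> K \<Longrightarrow> 0 < f x"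
  obtains d where "0 < d" "\<And>x. x \<in> K \<Longrightarrow> d \<le> f x"
proof
  \<comment> \<open>The inserted 1 keeps the minimum meaningful when \<open>K\<close> is
    empty.\<close>
  show "0 < Min (insert 1 (f ` K))"
    using assms by (subst Min_gr_iff) auto
  show "Min (insert 1 (f ` K)) \<le> f x" if "x \<in> K" for x
    using assms that by (intro Min_le) auto
qed

lemma finite_upper_bound:
  fixes f :: "'a \<Rightarrow> real"
  assumes "finite K"
  obtains c where "0 < c" "\<And>x. x \<in> K \<Longrightarrow> f x \<le> c"
proof
  show "0 < Max (insert 1 (f ` K))"
    using assms by (subst Max_gr_iff) auto
  show "f x \<le> Max (insert 1 (f ` K))" if "x \<in> K" for x
    using assms that by (intro Max_ge) auto
qed

locale positive_matrix =
  fixes J :: "'i set" and P :: "'i \<Rightarrow> 'i \<Rightarrow> real"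
  assumes finite_J: "finite J" and nonempty_J: "J \<noteq> {}"
    and pos: "i \<in> J \<Longrightarrow> j \<in> J \<Longrightarrow> 0 < P i j"
begin

lemma mat_app_mono:
  assumes "i \<in> J" "\<And>j. j \<in> J \<Longrightarrow> x j \<le> y j"
  shows "mat_app J P x i \<le> mat_app J P y i"
  unfolding mat_app_def using assms pos by (intro sum_mono mult_left_mono) (auto simp: less_imp_le)

lemma mat_app_strict_mono:
  assumes "i \<in> J" "\<And>j. j \<in> J \<Longrightarrow> x j \<le> y j" "s \<in> J" "x s < y s"
  shows "mat_app J P x i < mat_app J P y i"
  unfolding mat_app_def
proof (rule sum_strict_mono_ex1)
  show "\<forall>j\<in>J. P i j * x j \<le> P i j * y j"
    using assms pos by (auto simp: less_imp_le)
  show "\<exists>j\<in>J. P i j * x j < P i j * y j"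
    using assms pos by auto
qed (rule finite_J)

lemma mat_app_pos:
  assumes "i \<in> J" "\<And>j. j \<in> J \<Longrightarrow> 0 < x j"
  shows "0 < mat_app J P x i"
  unfolding mat_app_def using assms pos nonempty_J finite_J by (intro sum_pos) auto

lemma mat_iter_pos: "i \<in> J \<Longrightarrow> 0 < mat_iter J P k i"
  by (induction k arbitrary: i) (auto simp: mat_iter_Suc intro!: mat_app_pos)

text \<open>Any two rows of \<open>P\<close> are entrywise comparable with one constant, and this
  survives multiplication by a nonnegative vector. Hence the same \<open>C\<close> serves all
  \<open>k\<close>.\<close>

lemma mat_iter_comparable:
  obtains C where "0 < C" "\<And>k i l. i \<in> J \<Longrightarrow> l \<in> J \<Longrightarrow> mat_iter J P k i \<le> C * mat_iter J P k l"
proof -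
  obtain c where c: "0 < c" "\<And>x. x \<in> J \<times> J \<times> J \<Longrightarrow> (\<lambda>(i, l, j). P i j / P l j) x \<le> c"
    using finite_upper_bound[of "J \<times> J \<times> J" "\<lambda>(i, l, j). P i j / P l j"] finite_J by blast
  have 1: "P i j \<le> c * P l j" if "i \<in> J" "l \<in> J" "j \<in> J" for i l j
    using c(2)[of "(i, l, j)"] that pos[of l j] by (simp add: field_simps)
  \<comment> \<open>This is the case \<open>i = l\<close> of the previous bound; it settles
    \<open>k = 0\<close>, where all entries are 1.\<close>
  have 2: "1 \<le> c"
    using nonempty_J 1 pos by fastforce
  have "mat_iter J P k i \<le> c * mat_iter J P k l" if "i \<in> J" "l \<in> J" for k i l
  proof (cases k)
    case (Suc m)
    have "(\<Sum>j\<in>J. P i j * mat_iter J P m j) \<le> (\<Sum>j\<in>J. c * P l j * mat_iter J P m j)"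
      using 1 that by (intro sum_mono mult_right_mono) (auto intro!: less_imp_le[OF mat_iter_pos])
    then show ?thesis
      by (simp add: Suc mat_iter_Suc mat_app_def sum_distrib_left mult_ac)
  qed (use 2 in simp)
  with c(1) show ?thesis
    using that by blast
qed

text \<open>
  One step of power iteration replaces the growth ratios by weighted averages of the previous
  ones, with weights bounded away from \<open>0\<close>; hence their oscillation contracts.
\<close>

lemma growth_ratio_contraction:
  obtains a0 D \<delta> where "0 < a0" "0 < \<delta>" "\<delta> \<le> 1"
    "\<And>k i l. i \<in> J \<Longrightarrow> l \<in> J \<Longrightarrow>
      a0 \<le> mat_iter J P (Suc k) i / mat_iter J P k i \<and>
      \<bar>mat_iter J P (Suc k) i / mat_iter J P k i - mat_iter J P (Suc k) l / mat_iter J P k l\<bar>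
        \<le> D * (1 - \<delta>) ^ k"
proof -
  define w where "w = mat_iter J P"
  define r where "r k i = w (Suc k) i / w k i" for k i
  \<comment> \<open>For fixed \<open>k\<close> and \<open>i\<close> these weights form a probability
    vector on \<open>J\<close>; averaging the ratios of step \<open>k\<close> with them gives the
    ratio of step \<open>k + 1\<close> at \<open>i\<close>.\<close>
  define q where "q k i j = P i j * w k j / w (Suc k) i" for k i j
  have wpos: "0 < w k i" if "i \<in> J" for k i
    using that by (simp add: w_def mat_iter_pos)
  have rpos: "0 < r k i" if "i \<in> J" for k i
    using that by (simp add: r_def wpos)
  have wS: "w (Suc k) i = (\<Sum>j\<in>J. P i j * w k j)" for k i
    by (simp add: w_def mat_iter_Suc mat_app_def)
  have qpos: "0 < q k i j" if "i \<in> J" "j \<in> J" for k i j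
    using that by (simp add: q_def wpos pos)
  have qsum: "(\<Sum>j\<in>J. q k i j) = 1" if "i \<in> J" for k i
    using wpos[OF that, of "Suc k"] by (simp add: q_def wS flip: sum_divide_distrib)
  have rS: "r (Suc k) i = (\<Sum>j\<in>J. q k i j * r k j)" if "i \<in> J" for k i
  proof -
    have "(\<Sum>j\<in>J. q k i j * r k j) = (\<Sum>j\<in>J. P i j * w (Suc k) j / w (Suc k) i)"
      by (intro sum.cong) (auto simp: q_def r_def dest: wpos[of _ k])
    also have "\<dots> = w (Suc (Suc k)) i / w (Suc k) i"
      by (subst wS[of "Suc k"]) (simp add: sum_divide_distrib)
    finally show ?thesis by (simp add: r_def)
  qed
  obtain C where C: "0 < C" "\<And>k i l. i \<in> J \<Longrightarrow> l \<in> J \<Longrightarrow> w k i \<le> C * w k l"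
    unfolding w_def by (rule mat_iter_comparable) blast
  \<comment> \<open>Here \<open>w 1 i\<close> is the sum of row \<open>i\<close> of
    \<open>P\<close>. Bounding every \<open>w k l\<close> by \<open>C * w k j\<close> inside
    \<open>w (Suc k) i\<close> shows that this expression, free of \<open>k\<close>, is a lower
    bound for \<open>q k i j\<close>.\<close>
  obtain \<delta> where \<delta>: "0 < \<delta>" "\<And>x. x \<in> J \<times> J \<Longrightarrow> \<delta> \<le> (\<lambda>(i, j). P i j / (C * w 1 i)) x"
  proof (rule finite_positive_lower_bound[of "J \<times> J" "\<lambda>(i, j). P i j / (C * w 1 i)"])
    show "0 < (\<lambda>(i, j). P i j / (C * w 1 i)) x" if "x \<in> J \<times> J" for x
      using that pos C(1) wpos by (auto intro!: divide_pos_pos mult_pos_pos)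
  qed (use finite_J in auto)
  have q\<delta>: "\<delta> \<le> q k i j" if "i \<in> J" "j \<in> J" for k i j
  proof -
    have "w (Suc k) i \<le> (\<Sum>l\<in>J. P i l * (C * w k j))"
      unfolding wS using that pos C(2) by (intro sum_mono mult_left_mono) (auto simp: less_imp_le)
    also have "\<dots> = C * w 1 i * w k j"
      using wS[of 0 i] by (simp add: w_def sum_distrib_left sum_distrib_right mult_ac)
    finally have *: "w (Suc k) i \<le> C * w 1 i * w k j" .
    have "\<delta> \<le> P i j / (C * w 1 i)"
      using \<delta>(2)[of "(i, j)"] that by simp
    also have "\<dots> = P i j * w k j / (C * w 1 i * w k j)"
      using wpos[OF that(2), of k] by simp
    also have "\<dots> \<le> P i j * w k j / w (Suc k) i"
      using * that wpos pos C(1) by (intro divide_left_mono) (auto intro!: mult_pos_pos less_imp_le)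
    finally show ?thesis by (simp add: q_def)
  qed
  obtain j0 where j0: "j0 \<in> J"
    using nonempty_J by blast
  have \<delta>1: "\<delta> \<le> 1"
  proof -
    have "\<delta> \<le> q 0 j0 j0" using q\<delta> j0 by blast
    also have "\<dots> \<le> (\<Sum>j\<in>J. q 0 j0 j)"
      using finite_J j0 qpos by (intro member_le_sum) (auto simp: less_imp_le)
    finally show ?thesis using qsum j0 by simp
  qed
  \<comment> \<open>The fixed coordinate \<open>j0\<close> has weight at least \<delta> in every
    average, which pulls the average away from the upper bound \<open>b\<close>. Applied to the
    negated ratios, the same estimate gives the lower bound.\<close>
  have upper: "(\<Sum>j\<in>J. q k i j * x j) \<le> b - \<delta> * (b - x j0)"
    if "i \<in> J" "\<And>j. j \<in> J \<Longrightarrow> x j \<le> b" for k i b and x :: "'i \<Rightarrow> real"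
  proof -
    have "\<delta> * (b - x j0) \<le> q k i j0 * (b - x j0)"
      using that q\<delta> j0 by (intro mult_right_mono) auto
    also have "\<dots> \<le> (\<Sum>j\<in>J. q k i j * (b - x j))"
      using finite_J j0 qpos that
      by (intro member_le_sum[of j0 J "\<lambda>j. q k i j * (b - x j)"]) (auto simp: less_imp_le)
    also have "\<dots> = (\<Sum>j\<in>J. q k i j) * b - (\<Sum>j\<in>J. q k i j * x j)"
      by (simp add: sum_subtractf sum_distrib_right right_diff_distrib)
    finally show ?thesis using qsum[OF that(1)] by simp
  qed
  obtain a0 where a0: "0 < a0" "\<And>i. i \<in> J \<Longrightarrow> a0 \<le> r 0 i"
    using finite_positive_lower_bound[of J "r 0"] finite_J rpos by auto
  obtain b0 where b0: "\<And>i. i \<in> J \<Longrightarrow> r 0 i \<le> b0"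
    using finite_upper_bound[of J "r 0"] finite_J by auto
  \<comment> \<open>The ratios of step \<open>k\<close> lie in an interval from \<open>a\<close> to
    \<open>b\<close> whose length bound shrinks by the factor \<open>1 - \<delta>\<close> per step.
    Keeping \<open>a0 \<le> a\<close> bounds the ratios away from 0, so that they may be divided by
    later.\<close>
  have main: "\<exists>a b. a0 \<le> a \<and> (\<forall>j\<in>J. a \<le> r k j \<and> r k j \<le> b) \<and> b - a \<le> (b0 - a0) * (1 - \<delta>) ^ k" for k
  proof (induction k)
    case 0
    then show ?case using a0 b0 by (intro exI[of _ a0] exI[of _ b0]) auto
  next
    case (Suc k)
    then obtain a b where ab: "a0 \<le> a" "\<And>j. j \<in> J \<Longrightarrow> a \<le> r k j" "\<And>j. j \<in> J \<Longrightarrow> r k j \<le> b"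
      "b - a \<le> (b0 - a0) * (1 - \<delta>) ^ k"
      by blast
    have up: "r (Suc k) i \<le> b - \<delta> * (b - r k j0)" if "i \<in> J" for i
      unfolding rS[OF that] using upper[OF that, of "r k" b] ab by simp
    have lo: "a + \<delta> * (r k j0 - a) \<le> r (Suc k) i" if "i \<in> J" for i
      unfolding rS[OF that] using upper[OF that, of "\<lambda>j. - r k j" "- a"] ab
      by (simp add: sum_negf algebra_simps)
    have "(b - \<delta> * (b - r k j0)) - (a + \<delta> * (r k j0 - a)) = (b - a) * (1 - \<delta>)"
      by (simp add: algebra_simps)
    also have "\<dots> \<le> (b0 - a0) * (1 - \<delta>) ^ k * (1 - \<delta>)"
      using ab \<delta>1 by (intro mult_right_mono) auto
    finally have osc: "(b - \<delta> * (b - r k j0)) - (a + \<delta> * (r k j0 - a)) \<le> (b0 - a0) * (1 - \<delta>) ^ Suc k"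
      by (simp add: mult_ac)
    have "0 \<le> \<delta> * (r k j0 - a)"
      using ab(2)[OF j0] \<delta>(1) by simp
    with ab(1) have "a0 \<le> a + \<delta> * (r k j0 - a)"
      by linarith
    with osc up lo show ?case
      by blast
  qed
  show ?thesis
  proof (rule that[OF a0(1) \<delta>(1) \<delta>1])
    fix k i l assume il: "i \<in> J" "l \<in> J"
    obtain a b where ab: "a0 \<le> a" "\<And>j. j \<in> J \<Longrightarrow> a \<le> r k j \<and> r k j \<le> b"
      "b - a \<le> (b0 - a0) * (1 - \<delta>) ^ k"
      using main[of k] by blast
    have "a0 \<le> r k i \<and> \<bar>r k i - r k l\<bar> \<le> (b0 - a0) * (1 - \<delta>) ^ k"
      using ab(1,3) ab(2)[OF il(1)] ab(2)[OF il(2)] by linarith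
    then show "a0 \<le> mat_iter J P (Suc k) i / mat_iter J P k i \<and>
      \<bar>mat_iter J P (Suc k) i / mat_iter J P k i - mat_iter J P (Suc k) l / mat_iter J P k l\<bar>
        \<le> (b0 - a0) * (1 - \<delta>) ^ k"
      by (simp add: r_def w_def)
  qed
qed

section \<open>Perron vector and Perron root\<close>

text \<open>The relative increment of the quotient is \<open>(ri - r0) / r0\<close>, a difference of
  growth ratios over a ratio bounded below by \<open>a0\<close>. It is geometrically small by
  contraction, and the quotients are bounded by \<open>C\<close>, so the increments are
  summable.\<close>

lemma perron_vec_tendsto:
  assumes i0: "i0 \<in> J" and i: "i \<in> J"
  shows "(\<lambda>k. mat_iter J P k i / mat_iter J P k i0) \<longlonglongrightarrow> perron_vec J i0 P i"
proof -
  define w where "w = mat_iter J P"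
  define x where "x k = w k i / w k i0" for k
  obtain a0 D \<delta> where *: "0 < a0" "0 < \<delta>" "\<delta> \<le> 1"
    "\<And>k i l. i \<in> J \<Longrightarrow> l \<in> J \<Longrightarrow> a0 \<le> w (Suc k) i / w k i \<and>
      \<bar>w (Suc k) i / w k i - w (Suc k) l / w k l\<bar> \<le> D * (1 - \<delta>) ^ k"
    unfolding w_def by (rule growth_ratio_contraction) blast
  obtain C where C: "0 < C" "\<And>k i l. i \<in> J \<Longrightarrow> l \<in> J \<Longrightarrow> w k i \<le> C * w k l"
    unfolding w_def by (rule mat_iter_comparable) blast
  have wpos: "0 < w k i" if "i \<in> J" for k i
    using that by (simp add: w_def mat_iter_pos)
  have bound: "norm (x (Suc k) - x k) \<le> C * (D / a0) * (1 - \<delta>) ^ k" for k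
  proof -
    define ri where "ri = w (Suc k) i / w k i"
    define r0 where "r0 = w (Suc k) i0 / w k i0"
    have r0: "a0 \<le> r0" and osc: "\<bar>ri - r0\<bar> \<le> D * (1 - \<delta>) ^ k"
      using *(4)[OF i i0, of k] *(4)[OF i0 i, of k] by (auto simp: ri_def r0_def)
    have x: "0 \<le> x k" "x k \<le> C"
      using wpos[OF i, of k] wpos[OF i0, of k] C(2)[OF i i0, of k]
      by (auto simp: x_def divide_le_eq)
    have "x (Suc k) - x k = x k * ((ri - r0) / r0)"
      using wpos[OF i, of k] wpos[OF i0, of k] wpos[OF i0, of "Suc k"]
      by (simp add: x_def ri_def r0_def field_simps)
    then have "norm (x (Suc k) - x k) = x k * (\<bar>ri - r0\<bar> / r0)"
      using x r0 *(1) by (simp add: abs_mult)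
    also have "\<dots> \<le> C * ((D * (1 - \<delta>) ^ k) / a0)"
      using x r0 *(1) osc by (intro mult_mono frac_le) auto
    finally show ?thesis by simp
  qed
  have "summable (\<lambda>k. C * (D / a0) * (1 - \<delta>) ^ k)"
    using *(2,3) by (intro summable_mult summable_geometric) auto
  then have "summable (\<lambda>k. x (Suc k) - x k)"
    by (rule summable_comparison_test'[OF _ bound])
  then have "(\<lambda>k. x 0 + (\<Sum>m<k. x (Suc m) - x m)) \<longlonglongrightarrow> x 0 + (\<Sum>m. x (Suc m) - x m)"
    by (intro tendsto_intros summable_LIMSEQ)
  then have "convergent x"
    by (auto simp: sum_lessThan_telescope convergent_def)
  then have "x \<longlonglongrightarrow> lim x"
    by (simp add: convergent_LIMSEQ_iff)
  then show ?thesis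
    unfolding perron_vec_def x_def[abs_def] w_def .
qed

text \<open>Comparability bounds all quotients below by \<open>1 / C\<close>, so positivity is not
  lost in the limit.\<close>

lemma perron_vec_pos:
  assumes i0: "i0 \<in> J" and i: "i \<in> J"
  shows "0 < perron_vec J i0 P i"
proof -
  obtain C where C: "0 < C"
    "\<And>k i l. i \<in> J \<Longrightarrow> l \<in> J \<Longrightarrow> mat_iter J P k i \<le> C * mat_iter J P k l"
    by (rule mat_iter_comparable) blast
  have "1 / C \<le> mat_iter J P k i / mat_iter J P k i0" for k
    using C(1) C(2)[OF i0 i, of k] mat_iter_pos[OF i0, of k] by (simp add: field_simps)
  then have "1 / C \<le> perron_vec J i0 P i"
    using LIMSEQ_le_const[OF perron_vec_tendsto[OF i0 i]] by blast
  with C(1) show ?thesis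
    by (meson less_le_trans zero_less_divide_1_iff)
qed

text \<open>The growth ratio at \<open>l\<close> tends to \<open>mat_app J P v l / v l\<close>,
  where \<open>v\<close> is the Perron vector. Contraction forces these limits to agree for all
  \<open>l\<close>, and at \<open>i0\<close>, where \<open>v\<close> is 1, the limit is the Perron
  root.\<close>

lemma perron_eigen:
  assumes i0: "i0 \<in> J" and i: "i \<in> J"
  shows "mat_app J P (perron_vec J i0 P) i = perron_root J i0 P * perron_vec J i0 P i"
proof -
  define w where "w = mat_iter J P"
  let ?v = "perron_vec J i0 P"
  obtain a0 D \<delta> where *: "0 < a0" "0 < \<delta>" "\<delta> \<le> 1"
    "\<And>k i l. i \<in> J \<Longrightarrow> l \<in> J \<Longrightarrow> a0 \<le> w (Suc k) i / w k i \<and>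
      \<bar>w (Suc k) i / w k i - w (Suc k) l / w k l\<bar> \<le> D * (1 - \<delta>) ^ k"
    unfolding w_def by (rule growth_ratio_contraction) blast
  have wpos: "0 < w k i" if "i \<in> J" for k i
    using that by (simp add: w_def mat_iter_pos)
  have x: "(\<lambda>k. w k l / w k i0) \<longlonglongrightarrow> ?v l" if "l \<in> J" for l
    unfolding w_def by (rule perron_vec_tendsto[OF i0 that])
  have r: "(\<lambda>k. w (Suc k) l / w k l) \<longlonglongrightarrow> mat_app J P ?v l / ?v l" if l: "l \<in> J" for l
  proof -
    have "(\<lambda>k. (\<Sum>j\<in>J. P l j * (w k j / w k i0)) / (w k l / w k i0)) \<longlonglongrightarrow> mat_app J P ?v l / ?v l"
      unfolding mat_app_def using perron_vec_pos[OF i0 l] by (intro tendsto_intros x l) auto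
    also have "(\<lambda>k. (\<Sum>j\<in>J. P l j * (w k j / w k i0)) / (w k l / w k i0)) = (\<lambda>k. w (Suc k) l / w k l)"
    proof
      fix k
      have "(\<Sum>j\<in>J. P l j * (w k j / w k i0)) = w (Suc k) l / w k i0"
        by (simp add: w_def mat_iter_Suc mat_app_def sum_divide_distrib)
      then show "(\<Sum>j\<in>J. P l j * (w k j / w k i0)) / (w k l / w k i0) = w (Suc k) l / w k l"
        using wpos[OF i0, of k] by simp
    qed
    finally show ?thesis .
  qed
  have "(\<lambda>k. D * (1 - \<delta>) ^ k) \<longlonglongrightarrow> D * 0"
    using *(2,3) by (intro tendsto_intros LIMSEQ_power_zero) auto
  then have null: "(\<lambda>k. D * (1 - \<delta>) ^ k) \<longlonglongrightarrow> 0"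
    by simp
  have "norm (w (Suc k) i / w k i - w (Suc k) i0 / w k i0) \<le> D * (1 - \<delta>) ^ k" for k
    using *(4)[OF i i0, of k] by (simp only: real_norm_def)
  then have "(\<lambda>k. w (Suc k) i / w k i - w (Suc k) i0 / w k i0) \<longlonglongrightarrow> 0"
    by (intro Lim_null_comparison[OF _ null] always_eventually allI)
  moreover have "(\<lambda>k. w (Suc k) i / w k i - w (Suc k) i0 / w k i0) \<longlonglongrightarrow>
      mat_app J P ?v i / ?v i - mat_app J P ?v i0 / ?v i0"
    by (intro tendsto_diff r i i0)
  ultimately have "mat_app J P ?v i / ?v i = mat_app J P ?v i0 / ?v i0"
    using LIMSEQ_unique by fastforce
  moreover have "?v i0 = 1"
    using x[OF i0] wpos[OF i0] by (simp add: less_le LIMSEQ_const_iff)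
  ultimately show ?thesis
    using perron_vec_pos[OF i0 i] by (simp add: perron_root_def field_simps)
qed

section \<open>Growth rates compared with an eigenvalue\<close>

lemma eigenvalue_pos:
  assumes "\<And>i. i \<in> J \<Longrightarrow> 0 < v i" "\<And>i. i \<in> J \<Longrightarrow> mat_app J P v i = \<rho> * v i"
  shows "0 < \<rho>"
proof -
  obtain i where i: "i \<in> J"
    using nonempty_J by blast
  have "0 < \<rho> * v i"
    using mat_app_pos[OF i, of v] assms i by simp
  then show ?thesis
    using assms(1)[OF i] by (simp add: zero_less_mult_iff)
qed

text \<open>
  One application of the positive matrix spreads a strict inequality at one coordinate to all of
  them.
\<close>

lemma subeigenvector_less_eigenvalue:
  assumes v: "\<And>i. i \<in> J \<Longrightarrow> 0 < v i" "\<And>i. i \<in> J \<Longrightarrow> mat_app J P v i = \<rho> * v i"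
    and u: "\<And>i. i \<in> J \<Longrightarrow> r * u i \<le> mat_app J P u i" "s \<in> J" "r * u s < mat_app J P u s"
      "\<And>i. i \<in> J \<Longrightarrow> 0 < u i"
  shows "r < \<rho>"
proof -
  define y where "y = mat_app J P u"
  have y: "r * y i < mat_app J P y i" if "i \<in> J" for i
    using mat_app_strict_mono[OF that, of "\<lambda>j. r * u j" y s] u
    by (simp add: y_def mat_app_scale)
  have ypos: "0 < y i" if "i \<in> J" for i
    using that u by (simp add: y_def mat_app_pos)
  \<comment> \<open>The least factor for which \<open>t * v\<close> dominates \<open>y\<close>, with
    equality at some \<open>i\<close>. Comparing the images under \<open>P\<close> at this
    \<open>i\<close> gives \<open>r * y i < \<rho> * y i\<close>.\<close>
  define t where "t = Max ((\<lambda>i. y i / v i) ` J)"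
  have "t \<in> (\<lambda>i. y i / v i) ` J"
    unfolding t_def using finite_J nonempty_J by (intro Max_in) auto
  then obtain i where i: "i \<in> J" "t = y i / v i"
    by blast
  have t: "y j \<le> t * v j" if "j \<in> J" for j
  proof -
    have "y j / v j \<le> t"
      unfolding t_def using that finite_J by (intro Max_ge) auto
    then show ?thesis using v(1)[OF that] by (simp add: divide_le_eq)
  qed
  have "r * y i < mat_app J P y i"
    by (rule y) fact
  also have "\<dots> \<le> mat_app J P (\<lambda>j. t * v j) i"
    using i t by (intro mat_app_mono) auto
  also have "\<dots> = \<rho> * (t * v i)"
    using v(2)[OF i(1)] by (simp add: mat_app_scale)
  also have "\<dots> = \<rho> * y i"
    using i v(1)[of i] by simp
  finally show ?thesis
    using ypos[OF i(1)] by simp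
qed

text \<open>The constant vector 1 dominates \<open>v / b\<close>, and each application of the
  monotone map \<open>mat_app J P\<close> multiplies \<open>v\<close> by \<rho>.\<close>

lemma mat_iter_lower_bound:
  assumes v: "\<And>i. i \<in> J \<Longrightarrow> 0 < v i" "\<And>i. i \<in> J \<Longrightarrow> mat_app J P v i = \<rho> * v i"
  obtains c where "0 < c" "\<And>k i. i \<in> J \<Longrightarrow> c * \<rho> ^ k \<le> mat_iter J P k i"
proof -
  obtain b where b: "0 < b" "\<And>i. i \<in> J \<Longrightarrow> v i \<le> b"
    using finite_upper_bound[OF finite_J, of v] by blast
  obtain a where a: "0 < a" "\<And>i. i \<in> J \<Longrightarrow> a \<le> v i"
    using finite_positive_lower_bound[OF finite_J, of v] v(1) by blast
  have \<rho>: "0 < \<rho>"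
    using eigenvalue_pos v by blast
  have *: "\<rho> ^ k * v i \<le> b * mat_iter J P k i" if "i \<in> J" for k i
    using that
  proof (induction k arbitrary: i)
    case (Suc k)
    have "\<rho> ^ Suc k * v i = \<rho> ^ k * mat_app J P v i"
      using v(2) Suc.prems by simp
    also have "\<dots> = mat_app J P (\<lambda>j. \<rho> ^ k * v j) i"
      by (simp add: mat_app_scale)
    also have "\<dots> \<le> mat_app J P (\<lambda>j. b * mat_iter J P k j) i"
      using Suc by (intro mat_app_mono) auto
    finally show ?case by (simp add: mat_app_scale mat_iter_Suc)
  qed (use b in simp)
  show ?thesis
  proof (rule that[of "a / b"])
    fix k i assume i: "i \<in> J"
    have "\<rho> ^ k * a \<le> \<rho> ^ k * v i"
      using a i \<rho> by (intro mult_left_mono) auto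
    also have "\<dots> \<le> b * mat_iter J P k i"
      by (rule *[OF i])
    finally show "a / b * \<rho> ^ k \<le> mat_iter J P k i"
      using b(1) by (simp add: field_simps)
  qed (use a b in simp)
qed

text \<open>For \<open>y = mat_app J P u\<close> the inequality is strict at every coordinate, so
  the largest quotient \<theta> of \<open>mat_app J P y\<close> and \<open>y\<close> is still below
  \<open>r\<close>. The vector 1 is dominated by \<open>y / a\<close>, whose iterates grow at most
  like \<open>\<theta> ^ k\<close>.\<close>

lemma mat_iter_upper_bound:
  assumes u: "\<And>i. i \<in> J \<Longrightarrow> 0 < u i" "\<And>i. i \<in> J \<Longrightarrow> mat_app J P u i \<le> r * u i"
    "s \<in> J" "mat_app J P u s < r * u s"
  obtains \<theta> c where "0 < \<theta>" "\<theta> < r" "0 < c" "\<And>k i. i \<in> J \<Longrightarrow> mat_iter J P k i \<le> c * \<theta> ^ k"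
proof -
  define y where "y = mat_app J P u"
  have y: "mat_app J P y i < r * y i" if "i \<in> J" for i
    using mat_app_strict_mono[OF that, of y "\<lambda>j. r * u j" s] u
    by (simp add: y_def mat_app_scale)
  have ypos: "0 < y i" if "i \<in> J" for i
    using that u by (simp add: y_def mat_app_pos)
  define \<theta> where "\<theta> = Max ((\<lambda>i. mat_app J P y i / y i) ` J)"
  have "\<theta> \<in> (\<lambda>i. mat_app J P y i / y i) ` J"
    unfolding \<theta>_def using finite_J nonempty_J by (intro Max_in) auto
  then obtain i where i: "i \<in> J" "\<theta> = mat_app J P y i / y i"
    by blast
  have \<theta>: "0 < \<theta>" "\<theta> < r"
    using i y[OF i(1)] ypos[OF i(1)] mat_app_pos[OF i(1), of y] ypos by (auto simp: divide_less_eq)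
  have \<theta>y: "mat_app J P y j \<le> \<theta> * y j" if "j \<in> J" for j
  proof -
    have "mat_app J P y j / y j \<le> \<theta>"
      unfolding \<theta>_def using that finite_J by (intro Max_ge) auto
    then show ?thesis using ypos[OF that] by (simp add: divide_le_eq)
  qed
  obtain b where b: "0 < b" "\<And>i. i \<in> J \<Longrightarrow> y i \<le> b"
    using finite_upper_bound[OF finite_J, of y] by blast
  obtain a where a: "0 < a" "\<And>i. i \<in> J \<Longrightarrow> a \<le> y i"
    using finite_positive_lower_bound[OF finite_J, of y] ypos by blast
  have *: "a * mat_iter J P k i \<le> \<theta> ^ k * y i" if "i \<in> J" for k i
    using that
  proof (induction k arbitrary: i)
    case (Suc k)
    have "a * mat_iter J P (Suc k) i = mat_app J P (\<lambda>j. a * mat_iter J P k j) i"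
      by (simp add: mat_app_scale mat_iter_Suc)
    also have "\<dots> \<le> mat_app J P (\<lambda>j. \<theta> ^ k * y j) i"
      using Suc by (intro mat_app_mono) auto
    also have "\<dots> = \<theta> ^ k * mat_app J P y i"
      by (simp add: mat_app_scale)
    also have "\<dots> \<le> \<theta> ^ k * (\<theta> * y i)"
      using \<theta>y[OF Suc.prems] \<theta>(1) by (intro mult_left_mono) auto
    finally show ?case by (simp add: mult_ac)
  qed (use a in simp)
  show ?thesis
  proof (rule that[OF \<theta>, of "b / a"])
    fix k i assume i: "i \<in> J"
    have "a * mat_iter J P k i \<le> \<theta> ^ k * y i"
      by (rule *[OF i])
    also have "\<dots> \<le> \<theta> ^ k * b"
      using b i \<theta> by (intro mult_left_mono) auto
    finally show "mat_iter J P k i \<le> b / a * \<theta> ^ k"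
      using a(1) by (simp add: field_simps)
  qed (use a b in simp)
qed

end

text \<open>The iterates of \<open>P\<close> grow at least like \<open>\<rho> ^ k\<close>, those of
  \<open>Q\<close> at most like \<open>\<theta> ^ k\<close> with \<open>\<theta> < \<rho>\<close>;
  the geometric gap eventually beats the constants.\<close>

lemma mat_iter_eventually_less:
  assumes P: "positive_matrix J P" and Q: "positive_matrix J Q"
    and v: "\<And>i. i \<in> J \<Longrightarrow> 0 < v i" "\<And>i. i \<in> J \<Longrightarrow> mat_app J P v i = \<rho> * v i"
    and Qv: "\<And>i. i \<in> J \<Longrightarrow> mat_app J Q v i \<le> \<rho> * v i" "s \<in> J" "mat_app J Q v s < \<rho> * v s"
  shows "eventually (\<lambda>k. \<forall>i\<in>J. mat_iter J Q k i < mat_iter J P k i) sequentially"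
proof -
  interpret P: positive_matrix J P by fact
  interpret Q: positive_matrix J Q by fact
  obtain c where c: "0 < c" "\<And>k i. i \<in> J \<Longrightarrow> c * \<rho> ^ k \<le> mat_iter J P k i"
    using P.mat_iter_lower_bound[of v \<rho>] v by blast
  obtain \<theta> d where \<theta>: "0 < \<theta>" "\<theta> < \<rho>" "0 < d"
    and d: "\<And>k i. i \<in> J \<Longrightarrow> mat_iter J Q k i \<le> d * \<theta> ^ k"
    using Q.mat_iter_upper_bound[of v \<rho> s] v Qv by blast
  have "(\<lambda>k. (\<theta> / \<rho>) ^ k) \<longlonglongrightarrow> 0"
    using \<theta> by (intro LIMSEQ_power_zero) auto
  then have "eventually (\<lambda>k. (\<theta> / \<rho>) ^ k < c / d) sequentially"
    using c(1) \<theta>(3) by (intro order_tendstoD) auto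
  then show ?thesis
  proof eventually_elim
    case (elim k)
    have "d * \<theta> ^ k < c * \<rho> ^ k"
      using elim \<theta> by (simp add: power_divide field_simps)
    then show ?case
      using c(2)[of _ k] d[of _ k] by (meson le_less_trans less_le_trans)
  qed
qed

section \<open>Congruence and measurability of the Perron data\<close>

lemma mat_iter_cong:
  assumes "\<And>i j. i \<in> J \<Longrightarrow> j \<in> J \<Longrightarrow> P i j = Q i j" "i \<in> J"
  shows "mat_iter J P k i = mat_iter J Q k i"
  using assms(2)
proof (induction k arbitrary: i)
  case (Suc k)
  then show ?case
    by (auto simp: mat_iter_Suc assms(1) intro!: mat_app_cong)
qed simp

lemma perron_vec_cong:
  assumes "\<And>i j. i \<in> J \<Longrightarrow> j \<in> J \<Longrightarrow> P i j = Q i j" "i0 \<in> J" "i \<in> J"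
  shows "perron_vec J i0 P i = perron_vec J i0 Q i"
  using mat_iter_cong[of J P Q, OF assms(1)] assms(2,3) by (simp add: perron_vec_def)

lemma perron_root_cong:
  assumes "\<And>i j. i \<in> J \<Longrightarrow> j \<in> J \<Longrightarrow> P i j = Q i j" "i0 \<in> J"
  shows "perron_root J i0 P = perron_root J i0 Q"
  unfolding perron_root_def using assms by (intro mat_app_cong perron_vec_cong) auto

lemma borel_measurable_mat_iter:
  assumes "\<And>i j. i \<in> J \<Longrightarrow> j \<in> J \<Longrightarrow> (\<lambda>x. P x i j) \<in> borel_measurable M" "i \<in> J"
  shows "(\<lambda>x. mat_iter J (P x) k i) \<in> borel_measurable M"
  using assms(2)
proof (induction k arbitrary: i)
  case (Suc k)
  then show ?case
    unfolding mat_iter_Suc mat_app_def using assms(1)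
    by (intro borel_measurable_sum borel_measurable_times) auto
qed simp

text \<open>The quotients of the power iteration are measurable, and \<open>lim\<close> is a Borel
  function of the sequence whether or not it converges.\<close>

lemma borel_measurable_perron_vec:
  assumes "\<And>i j. i \<in> J \<Longrightarrow> j \<in> J \<Longrightarrow> (\<lambda>x. P x i j) \<in> borel_measurable M" "i0 \<in> J" "i \<in> J"
  shows "(\<lambda>x. perron_vec J i0 (P x) i) \<in> borel_measurable M"
  unfolding perron_vec_def using assms
  by (intro borel_measurable_lim_metric borel_measurable_divide borel_measurable_mat_iter) auto

lemma borel_measurable_perron_root:
  assumes "\<And>i j. i \<in> J \<Longrightarrow> j \<in> J \<Longrightarrow> (\<lambda>x. P x i j) \<in> borel_measurable M" "i0 \<in> J"
  shows "(\<lambda>x. perron_root J i0 (P x)) \<in> borel_measurable M"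
  unfolding perron_root_def mat_app_def using assms
  by (intro borel_measurable_sum borel_measurable_times borel_measurable_perron_vec) auto

section \<open>Survival probabilities under stationary strategies\<close>

lemma first_period_le_iff: "first_period z h \<le> enat t \<longleftrightarrow> (\<exists>i<t. fst (h i) = z)"
proof -
  \<comment> \<open>An infimum is easily compared with lower bounds, so the claim is negated first.
    Index \<open>i\<close> stands for period \<open>Suc i\<close>; hence the indices below
    \<open>t\<close> cover the periods up to \<open>t\<close>.\<close>
  have "first_period z h \<le> enat t \<longleftrightarrow> \<not> enat (Suc t) \<le> first_period z h"
    by (simp add: Suc_ile_eq not_less)
  also have "enat (Suc t) \<le> first_period z h \<longleftrightarrow> (\<forall>i. fst (h i) = z \<longrightarrow> t \<le> i)"
    by (simp add: first_period_def le_INF_iff)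
  finally show ?thesis
    by (auto simp: not_le)
qed

text \<open>Defined for all pairs of states; the restriction to the safe states comes from the index
  set given to \<open>mat_app\<close>.\<close>

definition policy_matrix :: "('s \<Rightarrow> 'a \<Rightarrow> 's pmf) \<Rightarrow> ('s \<Rightarrow> 'a pmf) \<Rightarrow> 's \<Rightarrow> 's \<Rightarrow> real" where
  "policy_matrix p \<sigma> i j = pmf (bind_pmf (\<sigma> i) (p i)) j"

text \<open>Integrating out the last state-action pair leaves an integrand of the same shape with
  one factor fewer. The test function \<open>g\<close> of the last pair preserves this shape, so the
  induction on \<open>k\<close> runs with \<open>g\<close> arbitrary.\<close>

lemma nn_integral_play_survival:
  fixes avoid s :: 's and g :: "'s \<times> 'a \<Rightarrow> ennreal"
  defines "I \<equiv> indicator (- {avoid}) :: 's \<Rightarrow> ennreal"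
  shows "(\<integral>\<^sup>+h. (\<Prod>i<Suc k. I (fst (h i))) * g (h k)
      \<partial>Ionescu_Tulcea.C (play_kernel p s \<sigma>) (\<lambda>_. count_space UNIV) 0 (Suc k) (\<lambda>_. undefined)) =
    I s * ((\<lambda>u z. \<integral>\<^sup>+z'. I z' * u z' \<partial>bind_pmf (\<sigma> z) (p z)) ^^ k) (\<lambda>z. \<integral>\<^sup>+a. g (z, a) \<partial>\<sigma> z) s"
proof -
  interpret Ionescu_Tulcea "play_kernel p s \<sigma>" "\<lambda>_. count_space UNIV"
    by (rule Ionescu_Tulcea_play_kernel)
  \<comment> \<open>The law of the state at index \<open>k\<close> given the earlier
    history.\<close>
  define D where "D k h = (case k of 0 \<Rightarrow> return_pmf s | Suc j \<Rightarrow> p (fst (h j)) (snd (h j)))"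
    for k and h :: "nat \<Rightarrow> 's \<times> 'a"
  have meas: "(\<lambda>h. (\<Prod>i<Suc k. I (fst (h i))) * g (h k)) \<in>
      borel_measurable (PiM {0..<Suc k} (\<lambda>_. count_space UNIV))" for k and g :: "'s \<times> 'a \<Rightarrow> ennreal"
  proof -
    have comp: "(\<lambda>h. f (h i)) \<in> borel_measurable (PiM {0..<Suc k} (\<lambda>_. count_space UNIV))"
      if "i < Suc k" for i and f :: "'s \<times> 'a \<Rightarrow> ennreal"
      using that by (intro measurable_compose[OF measurable_component_singleton]) auto
    show ?thesis
      by (intro borel_measurable_times_ennreal borel_measurable_prod_ennreal)
        (auto intro: comp[of _ "\<lambda>x. I (fst x)"] comp[of k g])
  qed
  have step: "(\<integral>\<^sup>+h. (\<Prod>i<Suc k. I (fst (h i))) * g (h k) \<partial>C 0 (Suc k) (\<lambda>_. undefined)) =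
      (\<integral>\<^sup>+h. (\<Prod>i<k. I (fst (h i))) * (\<integral>\<^sup>+z. I z * (\<integral>\<^sup>+a. g (z, a) \<partial>\<sigma> z) \<partial>D k h)
        \<partial>C 0 k (\<lambda>_. undefined))" for k and g :: "'s \<times> 'a \<Rightarrow> ennreal"
  proof -
    have "(\<integral>\<^sup>+h. (\<Prod>i<Suc k. I (fst (h i))) * g (h k) \<partial>C 0 (Suc k) (\<lambda>_. undefined)) =
      (\<integral>\<^sup>+h. \<integral>\<^sup>+h'. (\<Prod>i<Suc k. I (fst (h' i))) * g (h' k) \<partial>eP k h \<partial>C 0 k (\<lambda>_. undefined))"
      using meas[of k g] measurable_C[of 0 k]
      by (simp del: prod.lessThan_Suc, subst nn_integral_bind[where B="PiM {0..<Suc k} (\<lambda>_. count_space UNIV)"])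
        (auto simp: measurable_cong_sets[OF sets_C refl])
    also have "\<dots> = (\<integral>\<^sup>+h. (\<Prod>i<k. I (fst (h i))) * (\<integral>\<^sup>+z. I z * (\<integral>\<^sup>+a. g (z, a) \<partial>\<sigma> z) \<partial>D k h)
        \<partial>C 0 k (\<lambda>_. undefined))"
    proof (rule nn_integral_cong)
      fix h assume "h \<in> space (C 0 k (\<lambda>_. undefined))"
      then have h: "h \<in> space (PiM {0..<k} (\<lambda>_. count_space UNIV))"
        by (simp add: space_C)
      have "(\<integral>\<^sup>+h'. (\<Prod>i<Suc k. I (fst (h' i))) * g (h' k) \<partial>eP k h) =
          (\<integral>\<^sup>+x. (\<Prod>i<k. I (fst (h i))) * (I (fst x) * g x) \<partial>play_kernel p s \<sigma> k h)"
        by (subst nn_integral_eP[OF h meas]) (simp add: mult.assoc)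
      also have "\<dots> = (\<Prod>i<k. I (fst (h i))) *
          (\<integral>\<^sup>+z. \<integral>\<^sup>+a. I z * g (z, a) \<partial>\<sigma> z \<partial>D k h)"
        by (simp add: play_kernel_def D_def nn_integral_cmult nn_integral_map_pmf)
      also have "\<dots> = (\<Prod>i<k. I (fst (h i))) * (\<integral>\<^sup>+z. I z * (\<integral>\<^sup>+a. g (z, a) \<partial>\<sigma> z) \<partial>D k h)"
        by (simp add: nn_integral_cmult)
      finally show "(\<integral>\<^sup>+h'. (\<Prod>i<Suc k. I (fst (h' i))) * g (h' k) \<partial>eP k h) = \<dots>" .
    qed
    finally show ?thesis .
  qed
  show ?thesis
  proof (induction k arbitrary: g)
    case 0
    show ?case
      unfolding step by (subst C.simps, subst nn_integral_return) (auto simp: D_def space_PiM)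
  next
    case (Suc k)
    define N where "N u z = (\<integral>\<^sup>+z'. I z' * u z' \<partial>bind_pmf (\<sigma> z) (p z))" for u and z :: 's
    \<comment> \<open>By the Markov property the integral left by \<open>step\<close> depends on the
      history only through its last pair, so it serves as the new test function.\<close>
    let ?g = "\<lambda>(z, a). \<integral>\<^sup>+z'. I z' * (\<integral>\<^sup>+a. g (z', a) \<partial>\<sigma> z') \<partial>p z a"
    have "(\<integral>\<^sup>+h. (\<Prod>i<Suc (Suc k). I (fst (h i))) * g (h (Suc k)) \<partial>C 0 (Suc (Suc k)) (\<lambda>_. undefined)) =
        (\<integral>\<^sup>+h. (\<Prod>i<Suc k. I (fst (h i))) * ?g (h k) \<partial>C 0 (Suc k) (\<lambda>_. undefined))"
      unfolding step[of "Suc k"] by (simp add: D_def split_beta del: prod.lessThan_Suc C.simps)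
    also have "\<dots> = I s * (N ^^ k) (\<lambda>z. \<integral>\<^sup>+a. ?g (z, a) \<partial>\<sigma> z) s"
      unfolding N_def[abs_def] by (rule Suc.IH)
    also have "(\<lambda>z. \<integral>\<^sup>+a. ?g (z, a) \<partial>\<sigma> z) = N (\<lambda>z. \<integral>\<^sup>+a. g (z, a) \<partial>\<sigma> z)"
      by (simp add: N_def[abs_def])
    \<comment> \<open>The induction hypothesis leaves the additional \<open>N\<close> innermost,
      hence the unfolding of the power from the right.\<close>
    also have "(N ^^ k) \<dots> = (N ^^ Suc k) (\<lambda>z. \<integral>\<^sup>+a. g (z, a) \<partial>\<sigma> z)"
      by (simp only: funpow_Suc_right comp_apply)
    finally show ?case
      by (simp only: N_def[abs_def])
  qed
qed

text \<open>Transitions stay in the finite set \<open>S\<close> and the indicator removes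
  \<open>avoid\<close>, so each integral is a finite sum over the safe states.\<close>

lemma (in safety_mdp) survival_operator_eq_mat_iter:
  assumes \<sigma>: "stationary_strategy S A \<sigma>" and z: "z \<in> S - {avoid}"
  shows "((\<lambda>u z. \<integral>\<^sup>+z'. indicator (- {avoid}) z' * u z' \<partial>bind_pmf (\<sigma> z) (p z)) ^^ k) (\<lambda>_. 1) z =
    ennreal (mat_iter (S - {avoid}) (policy_matrix p \<sigma>) k z)"
  using z
proof (induction k arbitrary: z)
  case (Suc k)
  define F :: "('s \<Rightarrow> ennreal) \<Rightarrow> 's \<Rightarrow> ennreal" where
    "F u z = (\<integral>\<^sup>+z'. indicator (- {avoid}) z' * u z' \<partial>bind_pmf (\<sigma> z) (p z))" for u z
  have supp: "set_pmf (bind_pmf (\<sigma> z) (p z)) \<subseteq> S"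
    using \<sigma> p_in_S[of z] Suc.prems unfolding stationary_strategy_def set_bind_pmf by blast
  have nonneg: "0 \<le> mat_iter (S - {avoid}) (policy_matrix p \<sigma>) k j" for j
    by (induction k arbitrary: j) (auto simp: mat_iter_Suc mat_app_def policy_matrix_def intro!: sum_nonneg)
  have "(F ^^ Suc k) (\<lambda>_. 1) z = F ((F ^^ k) (\<lambda>_. 1)) z"
    by simp
  also have "\<dots> = (\<Sum>j\<in>S - {avoid}. indicator (- {avoid}) j * (F ^^ k) (\<lambda>_. 1) j *
      ennreal (pmf (bind_pmf (\<sigma> z) (p z)) j))"
    unfolding F_def using finite_S supp
    by (intro nn_integral_measure_pmf_support) auto
  also have "\<dots> = (\<Sum>j\<in>S - {avoid}. ennreal (policy_matrix p \<sigma> z j * mat_iter (S - {avoid}) (policy_matrix p \<sigma>) k j))"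
  proof (rule sum.cong)
    fix j assume j: "j \<in> S - {avoid}"
    have "(F ^^ k) (\<lambda>_. 1) j = ennreal (mat_iter (S - {avoid}) (policy_matrix p \<sigma>) k j)"
      unfolding F_def[abs_def] by (rule Suc.IH[OF j])
    then show "indicator (- {avoid}) j * (F ^^ k) (\<lambda>_. 1) j * ennreal (pmf (bind_pmf (\<sigma> z) (p z)) j) =
        ennreal (policy_matrix p \<sigma> z j * mat_iter (S - {avoid}) (policy_matrix p \<sigma>) k j)"
      using j nonneg by (simp add: policy_matrix_def ennreal_mult mult.commute)
  qed simp
  also have "\<dots> = ennreal (mat_iter (S - {avoid}) (policy_matrix p \<sigma>) (Suc k) z)"
    by (subst sum_ennreal) (auto simp: mat_iter_Suc mat_app_def policy_matrix_def nonneg)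
  finally show ?case
    by (simp add: F_def[abs_def])
qed simp

text \<open>The complement is a cylinder event on the first \<open>Suc k\<close> pairs. Only
  \<open>k\<close> transitions lead from period 1 to period \<open>Suc k\<close>, hence the index
  \<open>k\<close> on the right.\<close>

lemma (in safety_mdp) prob_first_period_le:
  assumes \<sigma>: "stationary_strategy S A \<sigma>" and s: "s \<in> S - {avoid}"
  shows "\<P>(h in play_measure p s \<sigma>. first_period avoid h \<le> enat (Suc k)) =
    1 - mat_iter (S - {avoid}) (policy_matrix p \<sigma>) k s"
proof -
  interpret Ionescu_Tulcea "play_kernel p s \<sigma>" "\<lambda>_. count_space UNIV"
    by (rule Ionescu_Tulcea_play_kernel)
  interpret play: prob_space "play_measure p s \<sigma>"
    by (rule prob_space_play_measure)
  let ?M = "\<lambda>_::nat. count_space UNIV :: ('s \<times> 'a) measure"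
  define X where "X = {h \<in> space (PiM {0..<Suc k} ?M). \<forall>i<Suc k. fst (h i) \<noteq> avoid}"
  have X: "X \<in> sets (PiM {0..<Suc k} ?M)"
  proof -
    have "(\<lambda>h. h i) -` {x. fst x \<noteq> avoid} \<inter> space (PiM {0..<Suc k} ?M) \<in> sets (PiM {0..<Suc k} ?M)"
      if "i \<in> {..<Suc k}" for i
      using that by (intro measurable_sets[OF measurable_component_singleton]) auto
    then have "(\<Inter>i\<in>{..<Suc k}. (\<lambda>h. h i) -` {x. fst x \<noteq> avoid} \<inter> space (PiM {0..<Suc k} ?M))
        \<in> sets (PiM {0..<Suc k} ?M)"
      by (intro sets.finite_INT) auto
    also have "(\<Inter>i\<in>{..<Suc k}. (\<lambda>h. h i) -` {x. fst x \<noteq> avoid} \<inter> space (PiM {0..<Suc k} ?M)) = X"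
      by (auto simp: X_def)
    finally show ?thesis .
  qed
  have sp: "space (play_measure p s \<sigma>) = space (PiM UNIV ?M)"
    and sets: "sets (play_measure p s \<sigma>) = sets (PiM UNIV ?M)"
    by (simp_all add: play_measure_def)
  define E where "E = PF.emb UNIV {0..<Suc k} X"
  have E: "E \<in> sets (play_measure p s \<sigma>)"
    unfolding E_def sets using X by (intro measurable_prod_emb) auto
  have "emeasure (play_measure p s \<sigma>) E = emeasure (C 0 (Suc k) (\<lambda>_. undefined)) X"
    unfolding play_measure_def E_def using X sets.sets_into_space[OF X]
    by (subst lim) (auto simp: emeasure_CI[of _ "Suc k"] prod_emb_id space_PiM)
  also have "\<dots> = (\<integral>\<^sup>+h. (\<Prod>i<Suc k. indicator (- {avoid}) (fst (h i))) * 1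
      \<partial>C 0 (Suc k) (\<lambda>_. undefined))"
  proof -
    have ind: "(\<Prod>i<m. indicator (- {avoid}) (fst (h i))) = (if \<forall>i<m. fst (h i) \<noteq> avoid then 1 else (0::ennreal))"
      for m and h :: "nat \<Rightarrow> 's \<times> 'a"
      by (induction m) (auto simp: less_Suc_eq)
    have "emeasure (C 0 (Suc k) (\<lambda>_. undefined)) X = (\<integral>\<^sup>+h. indicator X h \<partial>C 0 (Suc k) (\<lambda>_. undefined))"
      using X sets_C[of "\<lambda>_. undefined" 0 "Suc k"]
      by (intro nn_integral_indicator[symmetric]) (simp del: C.simps)
    also have "\<dots> = (\<integral>\<^sup>+h. (\<Prod>i<Suc k. indicator (- {avoid}) (fst (h i))) * 1 \<partial>C 0 (Suc k) (\<lambda>_. undefined))"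
    proof (rule nn_integral_cong)
      fix h assume "h \<in> space (C 0 (Suc k) (\<lambda>_. undefined))"
      then have "h \<in> space (PiM {0..<Suc k} ?M)"
        using space_C[of "\<lambda>_. undefined" 0 "Suc k"] by (simp del: C.simps)
      then show "indicator X h = (\<Prod>i<Suc k. indicator (- {avoid}) (fst (h i))) * (1::ennreal)"
        unfolding ind X_def by (simp add: indicator_def)
    qed
    finally show ?thesis .
  qed
  also have "\<dots> = ennreal (mat_iter (S - {avoid}) (policy_matrix p \<sigma>) k s)"
    using s by (subst nn_integral_play_survival) (simp add: survival_operator_eq_mat_iter[OF \<sigma> s] del: nn_integral_bind_pmf)
  finally have "emeasure (play_measure p s \<sigma>) E = ennreal (mat_iter (S - {avoid}) (policy_matrix p \<sigma>) k s)" .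
  moreover have "0 \<le> mat_iter (S - {avoid}) (policy_matrix p \<sigma>) k s"
    by (induction k arbitrary: s) (auto simp: mat_iter_Suc mat_app_def policy_matrix_def intro!: sum_nonneg)
  ultimately have 1: "play.prob E = mat_iter (S - {avoid}) (policy_matrix p \<sigma>) k s"
    by (simp add: measure_def)
  have "{h \<in> space (play_measure p s \<sigma>). first_period avoid h \<le> enat (Suc k)} =
      space (play_measure p s \<sigma>) - E"
    by (auto simp: E_def prod_emb_def X_def first_period_le_iff sp space_PiM)
  then show ?thesis
    using play.prob_compl[OF E] 1 by simp
qed

section \<open>From survival probabilities to overtaking\<close>

text \<open>Randomising averages the rows of the single actions, so inequalities known for each
  action pass to all stationary strategies.\<close>

lemma (in safety_mdp) mat_app_policy_matrix:
  assumes "stationary_strategy S A \<tau>" "i \<in> S"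
  shows "mat_app J (policy_matrix p \<tau>) x i = (\<Sum>a\<in>A i. pmf (\<tau> i) a * (\<Sum>j\<in>J. pmf (p i a) j * x j))"
proof -
  have "set_pmf (\<tau> i) \<subseteq> A i" "finite (A i)"
    using assms finite_A by (auto simp: stationary_strategy_def)
  then have "policy_matrix p \<tau> i j = (\<Sum>a\<in>A i. pmf (\<tau> i) a * pmf (p i a) j)" for j
    unfolding policy_matrix_def pmf_bind by (subst integral_measure_pmf[of "A i"]) auto
  then have "mat_app J (policy_matrix p \<tau>) x i = (\<Sum>j\<in>J. \<Sum>a\<in>A i. pmf (\<tau> i) a * (pmf (p i a) j * x j))"
    by (simp add: mat_app_def sum_distrib_right mult.assoc)
  also have "\<dots> = (\<Sum>a\<in>A i. \<Sum>j\<in>J. pmf (\<tau> i) a * (pmf (p i a) j * x j))"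
    by (rule sum.swap)
  finally show ?thesis
    by (simp add: sum_distrib_left)
qed

lemma (in safety_mdp) overtakes_if_eventually_survives_more:
  assumes "stationary_strategy S A \<sigma>" "stationary_strategy S A \<tau>" "s \<in> S - {avoid}"
    and "eventually (\<lambda>k. mat_iter (S - {avoid}) (policy_matrix p \<tau>) k s <
      mat_iter (S - {avoid}) (policy_matrix p \<sigma>) k s) sequentially"
  shows "overtakes avoid p s \<sigma> \<tau>"
proof -
  obtain K where K: "\<And>k. k \<ge> K \<Longrightarrow> mat_iter (S - {avoid}) (policy_matrix p \<tau>) k s <
      mat_iter (S - {avoid}) (policy_matrix p \<sigma>) k s"
    using assms(4) by (auto simp: eventually_sequentially)
  show ?thesis
    unfolding overtakes_def
  proof (intro exI[of _ "Suc K"] allI impI)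
    fix t assume "Suc K \<le> t"
    then obtain k where "t = Suc k" "K \<le> k"
      by (cases t) auto
    then show "\<P>(h in play_measure p s \<sigma>. first_period avoid h \<le> enat t) <
        \<P>(h in play_measure p s \<tau>. first_period avoid h \<le> enat t)"
      using K[of k] assms(1-3) by (simp add: prob_first_period_le)
  qed
qed

text \<open>The deterministic half of the argument. The hypothesis \<open>generic\<close> excludes
  ties between actions as measured by Perron vectors; for a pure policy of maximal Perron root,
  policy improvement then makes the inequality strict for each other action.\<close>

lemma (in safety_mdp) generic_overtaking:
  fixes i0 :: 's
  defines "J \<equiv> S - {avoid}"
  defines "v \<equiv> \<lambda>f. perron_vec J i0 (\<lambda>i. pmf (p i (f i)))"
    and "\<rho> \<equiv> \<lambda>f. perron_root J i0 (\<lambda>i. pmf (p i (f i)))"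
  assumes i0: "i0 \<in> J"
    and p_pos: "\<And>i j a. i \<in> J \<Longrightarrow> j \<in> J \<Longrightarrow> a \<in> A i \<Longrightarrow> 0 < pmf (p i a) j"
    and generic: "\<And>f s b. f \<in> PiE J A \<Longrightarrow> s \<in> J \<Longrightarrow> b \<in> A s \<Longrightarrow> b \<noteq> f s \<Longrightarrow>
      (\<Sum>j\<in>J. pmf (p s b) j * v f j) \<noteq> \<rho> f * v f s"
  shows "\<exists>\<sigma>. pure_stationary_strategy S A \<sigma> \<and>
    (\<forall>\<tau>. stationary_strategy S A \<tau> \<and> (\<exists>z\<in>J. \<tau> z \<noteq> \<sigma> z) \<longrightarrow> (\<forall>s\<in>J. overtakes avoid p s \<sigma> \<tau>))"
proof -
  have JS: "J \<subseteq> S" and finJ: "finite J"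
    using finite_S by (auto simp: J_def)
  have pos_matrix: "positive_matrix J (\<lambda>i. pmf (p i (f i)))" if "f \<in> PiE J A" for f
    using that finJ i0 p_pos by unfold_locales (auto simp: PiE_iff)
  have v_pos: "0 < v f i" if "f \<in> PiE J A" "i \<in> J" for f i
    unfolding v_def by (rule positive_matrix.perron_vec_pos[OF pos_matrix[OF that(1)] i0 that(2)])
  have v_eigen: "(\<Sum>j\<in>J. pmf (p i (f i)) j * v f j) = \<rho> f * v f i" if "f \<in> PiE J A" "i \<in> J" for f i
    using positive_matrix.perron_eigen[OF pos_matrix[OF that(1)] i0 that(2)]
    by (simp add: mat_app_def v_def \<rho>_def)
  have "finite (\<rho> ` PiE J A)" "\<rho> ` PiE J A \<noteq> {}"
    using finJ JS finite_A nonempty_A by (auto intro!: finite_imageI finite_PiE simp: PiE_eq_empty_iff)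
  then have "Max (\<rho> ` PiE J A) \<in> \<rho> ` PiE J A" "\<And>g. g \<in> PiE J A \<Longrightarrow> \<rho> g \<le> Max (\<rho> ` PiE J A)"
    by auto
  then obtain f where f: "f \<in> PiE J A" and f_max: "\<And>g. g \<in> PiE J A \<Longrightarrow> \<rho> g \<le> \<rho> f"
    by (metis imageE)
  have strict: "(\<Sum>j\<in>J. pmf (p s b) j * v f j) < \<rho> f * v f s" if s: "s \<in> J" and b: "b \<in> A s" "b \<noteq> f s" for s b
  proof (rule ccontr)
    assume "\<not> ?thesis"
    then have gt: "\<rho> f * v f s < (\<Sum>j\<in>J. pmf (p s b) j * v f j)"
      using generic[OF f s b] by simp
    \<comment> \<open>If \<open>b\<close> did better, switching to it at \<open>s\<close> alone
      would turn \<open>v f\<close> into a vector that the new matrix expands by at least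
      \<open>\<rho> f\<close>, strictly so at \<open>s\<close>; the Perron root would exceed the
      maximum.\<close>
    define g where "g = f(s := b)"
    have g: "g \<in> PiE J A"
      using f s b by (auto simp: g_def PiE_iff extensional_def)
    interpret positive_matrix J "\<lambda>i. pmf (p i (g i))"
      by (rule pos_matrix[OF g])
    have "\<rho> f < \<rho> g"
    proof (rule subeigenvector_less_eigenvalue[of "v g" "\<rho> g" "\<rho> f" "v f" s])
      show "\<rho> f * v f i \<le> mat_app J (\<lambda>i. pmf (p i (g i))) (v f) i" if "i \<in> J" for i
        using v_eigen[OF f that] gt by (auto simp: mat_app_def g_def)
      show "\<rho> f * v f s < mat_app J (\<lambda>i. pmf (p i (g i))) (v f) s"
        using gt by (simp add: mat_app_def g_def)
    qed (use s f g v_pos v_eigen in \<open>auto simp: mat_app_def\<close>)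
    with f_max[OF g] show False by simp
  qed
  \<comment> \<open>At \<open>avoid\<close> an arbitrary available action completes the
    strategy.\<close>
  define \<sigma> where "\<sigma> z = return_pmf (if z \<in> J then f z else SOME a. a \<in> A z)" for z
  have \<sigma>: "stationary_strategy S A \<sigma>"
    using f nonempty_A some_in_eq by (auto simp: stationary_strategy_def \<sigma>_def PiE_iff)
  show ?thesis
  proof (intro exI[of _ \<sigma>] conjI allI impI ballI)
    show "pure_stationary_strategy S A \<sigma>"
      using \<sigma> by (auto simp: pure_stationary_strategy_def \<sigma>_def)
    fix \<tau> s
    assume "stationary_strategy S A \<tau> \<and> (\<exists>z\<in>J. \<tau> z \<noteq> \<sigma> z)" and s: "s \<in> J"
    then obtain z where \<tau>: "stationary_strategy S A \<tau>" and z: "z \<in> J" "\<tau> z \<noteq> \<sigma> z"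
      by blast
    have policy_pos: "positive_matrix J (policy_matrix p \<pi>)" if \<pi>: "stationary_strategy S A \<pi>" for \<pi>
    proof
      fix i j assume ij: "i \<in> J" "j \<in> J"
      obtain a where a: "a \<in> set_pmf (\<pi> i)"
        using set_pmf_not_empty[of "\<pi> i"] by blast
      then have "a \<in> A i"
        using \<pi> ij JS by (auto simp: stationary_strategy_def)
      then have "j \<in> set_pmf (p i a)"
        using p_pos[OF ij, of a] by (auto simp: set_pmf_iff)
      with a show "0 < policy_matrix p \<pi> i j"
        unfolding policy_matrix_def by (intro pmf_positive) auto
    qed (use finJ i0 in auto)
    have row_le: "(\<Sum>j\<in>J. pmf (p i a) j * v f j) \<le> \<rho> f * v f i" if "i \<in> J" "a \<in> A i" for i a
      using strict[OF that] v_eigen[OF f that(1)] by (cases "a = f i") auto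
    have \<tau>_sum: "(\<Sum>a\<in>A i. pmf (\<tau> i) a * (\<rho> f * v f i)) = \<rho> f * v f i" if "i \<in> J" for i
      using \<tau> that JS finite_A[of i]
      by (subst sum_distrib_right[symmetric], subst sum_pmf_eq_1) (auto simp: stationary_strategy_def)
    have app: "mat_app J (policy_matrix p \<tau>) (v f) i =
        (\<Sum>a\<in>A i. pmf (\<tau> i) a * (\<Sum>j\<in>J. pmf (p i a) j * v f j))" if "i \<in> J" for i
      using that JS by (intro mat_app_policy_matrix \<tau>) auto
    have "eventually (\<lambda>k. \<forall>i\<in>J. mat_iter J (policy_matrix p \<tau>) k i < mat_iter J (policy_matrix p \<sigma>) k i) sequentially"
    proof (rule mat_iter_eventually_less[of J _ _ "v f" "\<rho> f" z])
      show "mat_app J (policy_matrix p \<sigma>) (v f) i = \<rho> f * v f i" if "i \<in> J" for i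
        using v_eigen[OF f that] that by (simp add: mat_app_def policy_matrix_def \<sigma>_def bind_return_pmf)
      show "mat_app J (policy_matrix p \<tau>) (v f) i \<le> \<rho> f * v f i" if "i \<in> J" for i
        unfolding app[OF that] using row_le that
        by (subst \<tau>_sum[OF that, symmetric]) (intro sum_mono mult_left_mono, auto)
      show "mat_app J (policy_matrix p \<tau>) (v f) z < \<rho> f * v f z"
        unfolding app[OF z(1)]
      proof (subst \<tau>_sum[OF z(1), symmetric], rule sum_strict_mono_ex1)
        show "finite (A z)"
          using z JS finite_A by auto
        show "\<forall>a\<in>A z. pmf (\<tau> z) a * (\<Sum>j\<in>J. pmf (p z a) j * v f j) \<le> pmf (\<tau> z) a * (\<rho> f * v f z)"
          using row_le z by (auto intro: mult_left_mono)
        \<comment> \<open>As \<open>\<sigma> z\<close> is concentrated on \<open>f z\<close>, a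
          different distribution gives positive weight to another action, for which the row
          inequality is strict.\<close>
        have "\<not> set_pmf (\<tau> z) \<subseteq> {f z}"
          using z by (simp add: \<sigma>_def set_pmf_subset_singleton)
        then obtain a where a: "a \<in> set_pmf (\<tau> z)" "a \<noteq> f z"
          by blast
        then have "a \<in> A z"
          using \<tau> z JS by (auto simp: stationary_strategy_def)
        with a show "\<exists>a\<in>A z. pmf (\<tau> z) a * (\<Sum>j\<in>J. pmf (p z a) j * v f j) < pmf (\<tau> z) a * (\<rho> f * v f z)"
          using strict z by (intro bexI[of _ a] mult_strict_left_mono) (auto simp: pmf_positive)
      qed
    qed (use policy_pos \<sigma> \<tau> v_pos f z in auto)
    then have "eventually (\<lambda>k. mat_iter J (policy_matrix p \<tau>) k s < mat_iter J (policy_matrix p \<sigma>) k s) sequentially"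
      by eventually_elim (use s in auto)
    then show "overtakes avoid p s \<sigma> \<tau>"
      using \<sigma> \<tau> s unfolding J_def by (intro overtakes_if_eventually_survives_more) auto
  qed
qed

section \<open>Random transition vectors\<close>

lemma open_simplex_sets: "open_simplex n \<in> sets (PiM {1..n} (\<lambda>_. borel))"
proof -
  have "open_simplex n = PiE {1..n} (\<lambda>_. {0<..<1}) \<inter>
      {q \<in> space (PiM {1..n} (\<lambda>_. borel)). (\<Sum>i=1..n. q i) = 1}"
    by (auto simp: open_simplex_def space_PiM PiE_def)
  also have "\<dots> \<in> sets (PiM {1..n} (\<lambda>_. borel))"
    by (intro sets.Int sets_PiM_I_finite) measurable
  finally show ?thesis .
qed

lemma space_simplex_lebesgue: "space (simplex_lebesgue n) = open_simplex n"
  by (auto simp: simplex_lebesgue_def space_restrict_space open_simplex_def space_PiM PiE_def)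

lemma measurable_simplex_lebesgue_component:
  assumes "j \<in> {1..n}"
  shows "(\<lambda>q. q j) \<in> borel_measurable (simplex_lebesgue n)"
  unfolding simplex_lebesgue_def using assms
  by (intro measurable_restrict_space1) (simp add: measurable_component_singleton)

text \<open>By Fubini: with the other coordinates fixed, the hyperplane meets the line in direction
  \<open>i\<close> in at most one point, because \<open>v i\<close> is nonzero.\<close>

lemma AE_PiM_lborel_not_hyperplane:
  fixes v :: "'i \<Rightarrow> real"
  assumes "finite I" "i \<in> I" "v i \<noteq> 0"
  shows "AE q in PiM I (\<lambda>_. lborel). (\<Sum>j\<in>I. q j * v j) \<noteq> c"
proof -
  interpret product_sigma_finite "\<lambda>_::'i. lborel :: real measure"
    by unfold_locales
  define K where "K = I - {i}"
  have I: "I = insert i K" "i \<notin> K" "finite K"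
    using assms by (auto simp: K_def)
  define H where "H = {q \<in> space (PiM I (\<lambda>_. lborel)). (\<Sum>j\<in>I. q j * v j) = c}"
  have H: "H \<in> sets (PiM I (\<lambda>_. lborel))"
    unfolding H_def by measurable
  have "emeasure (PiM I (\<lambda>_. lborel)) H = (\<integral>\<^sup>+q. indicator H q \<partial>PiM I (\<lambda>_. lborel))"
    by (rule nn_integral_indicator[OF H, symmetric])
  also have "\<dots> = (\<integral>\<^sup>+x. \<integral>\<^sup>+y. indicator H (x(i := y)) \<partial>lborel \<partial>PiM K (\<lambda>_. lborel))"
    unfolding I(1) using H I by (intro product_nn_integral_insert) (auto simp: I(1))
  also have "\<dots> = (\<integral>\<^sup>+x. 0 \<partial>PiM K (\<lambda>_. lborel :: real measure))"
  proof (rule nn_integral_cong)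
    fix x :: "'i \<Rightarrow> real"
    let ?y = "(c - (\<Sum>j\<in>K. x j * v j)) / v i"
    have "y = ?y" if "x(i := y) \<in> H" for y
    proof -
      have "(\<Sum>j\<in>I. (x(i := y)) j * v j) = c"
        using that by (simp only: H_def mem_Collect_eq)
      moreover have "(\<Sum>j\<in>I. (x(i := y)) j * v j) = y * v i + (\<Sum>j\<in>K. (x(i := y)) j * v j)"
        by (simp only: I(1) sum.insert[OF I(3,2)] fun_upd_same)
      moreover have "(\<Sum>j\<in>K. (x(i := y)) j * v j) = (\<Sum>j\<in>K. x j * v j)"
        using I by (intro sum.cong) auto
      ultimately have "y * v i = c - (\<Sum>j\<in>K. x j * v j)"
        by linarith
      then show ?thesis
        by (simp add: eq_divide_eq assms(3))
    qed
    note unique = this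
    have "indicator H (x(i := y)) \<le> (indicator {?y} y :: ennreal)" for y
      using unique[of y] by (auto simp: indicator_def)
    then have "(\<integral>\<^sup>+y. indicator H (x(i := y)) \<partial>lborel) \<le> (\<integral>\<^sup>+y. indicator {?y} y \<partial>lborel)"
      by (intro nn_integral_mono)
    then show "(\<integral>\<^sup>+y. indicator H (x(i := y)) \<partial>lborel) = 0"
      by simp
  qed
  finally have "emeasure (PiM I (\<lambda>_. lborel)) H = 0"
    by simp
  then have "H \<in> null_sets (PiM I (\<lambda>_. lborel))"
    using H by auto
  then show ?thesis
    by (rule AE_I') (auto simp: H_def)
qed

text \<open>The measure is an image of Lebesgue measure under a map that only adds coordinate
  \<open>n\<close>, and the linear form involves only the first \<open>n - 1\<close>
  coordinates.\<close>

lemma AE_simplex_lebesgue_not_hyperplane: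
  assumes "i \<in> {1..<n}" "v i \<noteq> 0"
  shows "AE q in simplex_lebesgue n. (\<Sum>j\<in>{1..<n}. q j * v j) \<noteq> c"
proof -
  let ?L = "PiM {1..<n} (\<lambda>_. lborel :: real measure)" and ?B = "PiM {1..n} (\<lambda>_. borel :: real measure)"
  let ?e = "\<lambda>q::nat \<Rightarrow> real. q(n := 1 - (\<Sum>i=1..<n. q i))"
  have n: "{1..n} = insert n {1..<n}"
    using assms by auto
  have e: "?e \<in> ?L \<rightarrow>\<^sub>M ?B"
    unfolding n by (intro measurable_fun_upd[where J = "{1..<n}"])
      (auto intro!: measurable_ident_sets sets_PiM_cong borel_measurable_diff borel_measurable_sum
        measurable_component_singleton[of _ _ "\<lambda>_. lborel", unfolded measurable_lborel2])
  have "AE q in distr ?L ?B ?e. (\<Sum>j\<in>{1..<n}. q j * v j) \<noteq> c"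
  proof (subst AE_distr_iff[OF e])
    have "(\<Sum>j\<in>{1..<n}. ?e q j * v j) = (\<Sum>j\<in>{1..<n}. q j * v j)" for q
      by (intro sum.cong) auto
    then show "AE q in ?L. (\<Sum>j\<in>{1..<n}. ?e q j * v j) \<noteq> c"
      using AE_PiM_lborel_not_hyperplane[of "{1..<n}" i v c] assms by (simp only:) auto
    have "(\<lambda>q. \<Sum>j\<in>{1..<n}. q j * v j) \<in> borel_measurable ?B"
      by (intro borel_measurable_sum borel_measurable_times) (auto intro!: measurable_component_singleton)
    then show "{q \<in> space ?B. (\<Sum>j\<in>{1..<n}. q j * v j) \<noteq> c} \<in> sets ?B"
      by measurable
  qed
  then show ?thesis
    unfolding simplex_lebesgue_def using open_simplex_sets[of n]
    by (subst AE_restrict_space_iff) (auto intro: sets.Int_space_eq2 simp: sets.sets_into_space Int_absorb2)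
qed

text \<open>As \<open>b\<close> differs from \<open>f s\<close>, the Perron data of \<open>f\<close>
  are computed from vectors independent of \<open>X (s, b)\<close>. Once those are fixed, the
  exceptional set for \<open>X (s, b)\<close> is a hyperplane, which is null because the law has a
  density.\<close>

lemma AE_not_perron_hyperplane:
  fixes X :: "nat \<times> 'a \<Rightarrow> 'w \<Rightarrow> nat \<Rightarrow> real"
  assumes "prob_space M" "n \<ge> 2"
    and indep: "prob_space.indep_vars M (\<lambda>_. simplex_lebesgue n) X I"
    and f: "\<And>i. i \<in> {1..<n} \<Longrightarrow> (i, f i) \<in> I" and sb: "(s, b) \<in> I" "s \<in> {1..<n}" "b \<noteq> f s"
    and dens: "distributed M (simplex_lebesgue n) (X (s, b)) g"
  shows "AE w in M. (\<Sum>j\<in>{1..<n}. X (s, b) w j * perron_vec {1..<n} 1 (\<lambda>i. X (i, f i) w) j) \<noteq>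
    perron_root {1..<n} 1 (\<lambda>i. X (i, f i) w) * perron_vec {1..<n} 1 (\<lambda>i. X (i, f i) w) s"
proof -
  interpret prob_space M by fact
  let ?L = "simplex_lebesgue n" and ?Z = "PiM {(s, b)} (\<lambda>_. simplex_lebesgue n)" and ?J = "{1..<n}"
  \<comment> \<open>The pairs that enter the matrix of \<open>f\<close>; \<open>(s, b)\<close> is
    not among them.\<close>
  define B where "B = (\<lambda>i. (i, f i)) ` ?J"
  define Y where "Y w = restrict (\<lambda>x. X x w) B" for w
  define Z where "Z w = restrict (\<lambda>x. X x w) {(s, b)}" for w
  define R where "R y i j = y (i, f i) j" for y :: "nat \<times> 'a \<Rightarrow> nat \<Rightarrow> real" and i j
  define good where "good = (\<lambda>(y, z). (\<Sum>j\<in>?J. z (s, b) j * perron_vec ?J 1 (R y) j) \<noteq>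
    perron_root ?J 1 (R y) * perron_vec ?J 1 (R y) s)"
  have one: "1 \<in> ?J"
    using \<open>n \<ge> 2\<close> by simp
  have comp: "(\<lambda>z. z (s, b)) \<in> ?Z \<rightarrow>\<^sub>M ?L"
    by (rule measurable_component_singleton) simp
  have "indep_var (PiM B (\<lambda>_. ?L)) Y (?Z) Z"
    unfolding Y_def[abs_def] Z_def[abs_def] using sb f
    by (intro indep_var_restrict[OF indep]) (auto simp: B_def)
  then have Y: "Y \<in> M \<rightarrow>\<^sub>M PiM B (\<lambda>_. ?L)" and Z: "Z \<in> M \<rightarrow>\<^sub>M ?Z"
    and prod: "distr M (PiM B (\<lambda>_. ?L)) Y \<Otimes>\<^sub>M distr M (?Z) Z =
      distr M (PiM B (\<lambda>_. ?L) \<Otimes>\<^sub>M ?Z) (\<lambda>w. (Y w, Z w))"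
    by (auto simp: indep_var_distribution_eq)
  interpret DY: prob_space "distr M (PiM B (\<lambda>_. ?L)) Y"
    by (rule prob_space_distr[OF Y])
  interpret DZ: prob_space "distr M ?Z Z"
    by (rule prob_space_distr[OF Z])
  interpret D: pair_prob_space "distr M (PiM B (\<lambda>_. ?L)) Y" "distr M ?Z Z" ..
  have R: "(\<lambda>x. R (fst x) i j) \<in> borel_measurable (PiM B (\<lambda>_. ?L) \<Otimes>\<^sub>M ?Z)" if "i \<in> ?J" "j \<in> ?J" for i j
  proof -
    have "(\<lambda>x. fst x (i, f i)) \<in> PiM B (\<lambda>_. ?L) \<Otimes>\<^sub>M ?Z \<rightarrow>\<^sub>M ?L"
      using that by (intro measurable_compose[OF measurable_fst measurable_component_singleton]) (auto simp: B_def)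
    then show ?thesis
      unfolding R_def using that by (intro measurable_compose[OF _ measurable_simplex_lebesgue_component]) auto
  qed
  have q: "(\<lambda>x. snd x (s, b) j) \<in> borel_measurable (PiM B (\<lambda>_. ?L) \<Otimes>\<^sub>M ?Z)" if "j \<in> ?J" for j
    using that
    by (intro measurable_compose[OF measurable_compose[OF measurable_snd comp] measurable_simplex_lebesgue_component]) auto
  have good_sets: "{x \<in> space (PiM B (\<lambda>_. ?L) \<Otimes>\<^sub>M ?Z). good x} \<in> sets (PiM B (\<lambda>_. ?L) \<Otimes>\<^sub>M ?Z)"
  proof -
    have vec: "(\<lambda>x. perron_vec ?J 1 (R (fst x)) i) \<in> borel_measurable (PiM B (\<lambda>_. ?L) \<Otimes>\<^sub>M ?Z)" if "i \<in> ?J" for i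
      using R one that by (intro borel_measurable_perron_vec) auto
    have root: "(\<lambda>x. perron_root ?J 1 (R (fst x))) \<in> borel_measurable (PiM B (\<lambda>_. ?L) \<Otimes>\<^sub>M ?Z)"
      using R one by (intro borel_measurable_perron_root) auto
    have "(\<lambda>x. \<Sum>j\<in>?J. snd x (s, b) j * perron_vec ?J 1 (R (fst x)) j) \<in> borel_measurable (PiM B (\<lambda>_. ?L) \<Otimes>\<^sub>M ?Z)"
      using vec q by (intro borel_measurable_sum borel_measurable_times) auto
    moreover have "(\<lambda>x. perron_root ?J 1 (R (fst x)) * perron_vec ?J 1 (R (fst x)) s)
        \<in> borel_measurable (PiM B (\<lambda>_. ?L) \<Otimes>\<^sub>M ?Z)"
      using vec[OF sb(2)] root by (intro borel_measurable_times)
    ultimately show ?thesis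
      unfolding good_def split_beta by (intro borel_measurable_neq)
  qed
  have "AE x in distr M (PiM B (\<lambda>_. ?L)) Y \<Otimes>\<^sub>M distr M ?Z Z. good x"
  proof (rule D.AE_pair_measure)
    show "{x \<in> space (distr M (PiM B (\<lambda>_. ?L)) Y \<Otimes>\<^sub>M distr M ?Z Z). good x} \<in>
        sets (distr M (PiM B (\<lambda>_. ?L)) Y \<Otimes>\<^sub>M distr M ?Z Z)"
      unfolding prod using good_sets by simp
    show "AE y in distr M (PiM B (\<lambda>_. ?L)) Y. AE z in distr M ?Z Z. good (y, z)"
    proof (rule AE_I2)
      fix y assume "y \<in> space (distr M (PiM B (\<lambda>_. ?L)) Y)"
      then have y: "y (i, f i) \<in> open_simplex n" if "i \<in> ?J" for i
        using that by (auto simp: space_PiM space_simplex_lebesgue B_def)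
      interpret positive_matrix ?J "R y"
        using one y by unfold_locales (auto simp: R_def open_simplex_def PiE_iff)
      \<comment> \<open>The coefficient of coordinate 1 is a Perron vector entry, hence positive, so
        this is a proper hyperplane.\<close>
      have "AE q in distr M ?L (X (s, b)). (\<Sum>j\<in>?J. q j * perron_vec ?J 1 (R y) j) \<noteq>
          perron_root ?J 1 (R y) * perron_vec ?J 1 (R y) s"
        unfolding distributed_distr_eq_density[OF dens] AE_density[OF distributed_borel_measurable[OF dens]]
        by (rule eventually_mono[OF AE_simplex_lebesgue_not_hyperplane[OF one, where v = "perron_vec ?J 1 (R y)"]])
          (use perron_vec_pos[OF one one] in auto)
      then have "AE w in M. good (y, Z w)"
        using AE_distrD[OF distributed_measurable[OF dens]] by (simp add: good_def Z_def)
      moreover have "{z \<in> space ?Z. good (y, z)} \<in> sets ?Z"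
      proof -
        have "(\<lambda>z. \<Sum>j\<in>?J. z (s, b) j * perron_vec ?J 1 (R y) j) \<in> borel_measurable ?Z"
          by (intro borel_measurable_sum borel_measurable_times borel_measurable_const
              measurable_compose[OF comp measurable_simplex_lebesgue_component]) auto
        then show ?thesis
          unfolding good_def split_beta by (intro borel_measurable_neq) auto
      qed
      ultimately show "AE z in distr M ?Z Z. good (y, z)"
        by (subst AE_distr_iff[OF Z])
    qed
  qed
  then have "AE w in M. good (Y w, Z w)"
    unfolding prod using good_sets Y Z by (subst (asm) AE_distr_iff) auto
  \<comment> \<open>\<open>Y w\<close> agrees with the full family only on \<open>B\<close>, which
    suffices since the Perron data depend only on entries indexed by \<open>J\<close>.\<close>
  moreover have "good (Y w, Z w) \<longleftrightarrow>
      (\<Sum>j\<in>?J. X (s, b) w j * perron_vec ?J 1 (\<lambda>i. X (i, f i) w) j) \<noteq>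
      perron_root ?J 1 (\<lambda>i. X (i, f i) w) * perron_vec ?J 1 (\<lambda>i. X (i, f i) w) s" for w
  proof -
    have vec_eq: "perron_vec ?J 1 (R (Y w)) i = perron_vec ?J 1 (\<lambda>i. X (i, f i) w) i" if "i \<in> ?J" for i
      using that one by (intro perron_vec_cong) (auto simp: R_def Y_def B_def)
    have root_eq: "perron_root ?J 1 (R (Y w)) = perron_root ?J 1 (\<lambda>i. X (i, f i) w)"
      using one by (intro perron_root_cong) (auto simp: R_def Y_def B_def)
    have sum_eq: "(\<Sum>j\<in>?J. Z w (s, b) j * perron_vec ?J 1 (R (Y w)) j) =
        (\<Sum>j\<in>?J. X (s, b) w j * perron_vec ?J 1 (\<lambda>i. X (i, f i) w) j)"
      by (intro sum.cong arg_cong2[where f = "(*)"] vec_eq) (auto simp: Z_def)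
    show ?thesis
      unfolding good_def prod.case sum_eq root_eq vec_eq[OF sb(2)] ..
  qed
  ultimately show ?thesis
    by simp
qed

section \<open>Almost sure genericity and conclusion\<close>

theorem mainTheorem7:
  fixes n :: nat
    and A :: "nat \<Rightarrow> 'a set"
    and M :: "'w measure"
    and p :: "'w \<Rightarrow> nat \<Rightarrow> 'a \<Rightarrow> nat pmf"
  assumes "n \<ge> 2"
    and "prob_space M"
    and "\<And>w. w \<in> space M \<Longrightarrow> safety_mdp {1..n} n A (p w)"
    and "\<And>s a. s \<in> {1..n} - {n} \<Longrightarrow> a \<in> A s \<Longrightarrow>
      \<exists>f. distributed M (simplex_lebesgue n) (\<lambda>w. transition_vector n (p w) s a) f"
    and "prob_space.indep_vars M (\<lambda>_. simplex_lebesgue n)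
      (\<lambda>(s, a) w. transition_vector n (p w) s a) (SIGMA s:{1..n} - {n}. A s)"
  shows "AE w in M. \<exists>\<sigma>. pure_stationary_strategy {1..n} A \<sigma> \<and>
    (\<forall>\<tau>. stationary_strategy {1..n} A \<tau> \<and> (\<exists>z\<in>{1..n} - {n}. \<tau> z \<noteq> \<sigma> z) \<longrightarrow>
      (\<forall>s\<in>{1..n} - {n}. overtakes n (p w) s \<sigma> \<tau>))"
proof -
  have J: "{1..n} - {n} = {1..<n}"
    by auto
  interpret prob_space M by fact
  \<comment> \<open>Finiteness of the action sets comes from the MDP at a sample point, and a
    probability space has one.\<close>
  obtain w0 where "w0 \<in> space M"
    using not_empty by blast
  then have finite_A: "finite (A s)" if "s \<in> {1..<n}" for s
    using that safety_mdp.finite_A[OF assms(3)] by auto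
  let ?P = "\<lambda>w f i. pmf (p w i (f i))"
  let ?generic = "\<lambda>w f s b. b \<noteq> f s \<longrightarrow> (\<Sum>j\<in>{1..<n}. pmf (p w s b) j * perron_vec {1..<n} 1 (?P w f) j) \<noteq>
      perron_root {1..<n} 1 (?P w f) * perron_vec {1..<n} 1 (?P w f) s"
  have "AE w in M. ?generic w f s b"
    if f: "f \<in> PiE {1..<n} A" and s: "s \<in> {1..<n}" and b: "b \<in> A s" for f s b
  proof (cases "b = f s")
    case False
    obtain g where g: "distributed M (simplex_lebesgue n) (\<lambda>w. transition_vector n (p w) s b) g"
      using assms(4)[of s b] s b by auto
    have one: "1 \<in> {1..<n}"
      using assms(1) by simp
    let ?T = "\<lambda>w i. transition_vector n (p w) i (f i)"
    have "AE w in M. (\<Sum>j\<in>{1..<n}. transition_vector n (p w) s b j * perron_vec {1..<n} 1 (?T w) j) \<noteq>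
        perron_root {1..<n} 1 (?T w) * perron_vec {1..<n} 1 (?T w) s"
      using AE_not_perron_hyperplane[OF assms(2,1,5), of f s b g] f s b g False
      by (auto simp: PiE_iff J)
    then show ?thesis
    proof eventually_elim
      case (elim w)
      have vec_eq: "perron_vec {1..<n} 1 (?T w) i = perron_vec {1..<n} 1 (?P w f) i" if "i \<in> {1..<n}" for i
        using that one by (intro perron_vec_cong) (auto simp: transition_vector_def)
      have root_eq: "perron_root {1..<n} 1 (?T w) = perron_root {1..<n} 1 (?P w f)"
        using one by (intro perron_root_cong) (auto simp: transition_vector_def)
      have sum_eq: "(\<Sum>j\<in>{1..<n}. transition_vector n (p w) s b j * perron_vec {1..<n} 1 (?T w) j) =
          (\<Sum>j\<in>{1..<n}. pmf (p w s b) j * perron_vec {1..<n} 1 (?P w f) j)"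
        by (intro sum.cong arg_cong2[where f = "(*)"] vec_eq) (auto simp: transition_vector_def)
      show ?case
        using elim unfolding sum_eq root_eq vec_eq[OF s] by blast
    qed
  qed simp
  \<comment> \<open>There are only finitely many triples \<open>f\<close>, \<open>s\<close>,
    \<open>b\<close>, so the exceptional null sets may be united.\<close>
  then have "AE w in M. \<forall>f\<in>PiE {1..<n} A. \<forall>s\<in>{1..<n}. \<forall>b\<in>A s. ?generic w f s b"
    using finite_A by (intro AE_finite_allI finite_PiE) auto
  then show ?thesis
    using AE_space
  proof eventually_elim
    case (elim w)
    interpret safety_mdp "{1..n}" n A "p w"
      by (rule assms(3)[OF elim(2)])
    \<comment> \<open>The transition vector is a measurable map into the open simplex, so this
      positivity holds at every sample point.\<close>
    have "0 < pmf (p w i a) j" if ija: "i \<in> {1..<n}" "j \<in> {1..<n}" "a \<in> A i" for i j a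
    proof -
      obtain g where g: "distributed M (simplex_lebesgue n) (\<lambda>w. transition_vector n (p w) i a) g"
        using assms(4)[of i a] ija by auto
      have "transition_vector n (p w) i a \<in> open_simplex n"
        using measurable_space[OF distributed_measurable[OF g] elim(2)] by (simp add: space_simplex_lebesgue)
      then show ?thesis
        using ija by (auto simp: open_simplex_def PiE_iff transition_vector_def)
    qed
    then show ?case
      using generic_overtaking[of 1] elim(1) assms(1) unfolding J by auto
  qed
qed

end
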